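(* Let $\mathcal{G}$ be a smooth semicomplete digraph with more than one cycle. Then there is a smooth semicomplete digraph $\mathcal{H}$ on the same vertex set, with more than one cycle, such that $\mathrm{id\mbox{-}Pol}(\mathcal{G}^+)\subseteq\mathrm{id\mbox{-}Pol}(\mathcal{H}^+)$ (the added sinks being identified) and $\mathcal{H}^+$ has the Novi Sad property.
   Context: A semicomplete digraph is a finite irreflexive digraph in which for all distinct vertices $x,y$ at least one of $(x,y),(y,x)$ is an edge. It is smooth if it has neither a source (in-degree zero vertex) nor a sink (out-degree zero vertex). Cycles are directed cycles (two opposite edges form a 2-cycle). For a digraph $\mathcal{G}$, $\mathcal{G}^+$ is $\mathcal{G}$ together with a new sink $t$ and edges $(v,t)$ for all vertices $v$ of $\mathcal{G}$. $\mathrm{id\mbox{-}Pol}$ denotes the set of idempotent polymorphisms (maps $f:V^k\to V$ sending edges coordinatewise to edges with $f(a,\dots,a)=a$). A semicomplete digraph $\mathcal{K}$ with more than one cycle and no source has the Novi Sad property if there are vertices $p,q$ such that for every vertex $v$ of $\mathcal{K}$, $(v,p)$ or $(v,q)$ is an edge.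
   Formalization: In the Novi Sad property the edges are taken as (p,v) or (q,v) for every vertex v, instead of (v,p) or (v,q); as literally written no digraph with a sink, hence no H^+, could have the property (take v = t). *)

theory Defs
  imports "Graph_Theory.Pair_Digraph" "HOL-Library.FuncSet"
begin

locale semicomplete_digraph = pair_digraph +
  assumes semicomplete:
    "\<lbrakk>x \<in> pverts G; y \<in> pverts G; x \<noteq> y\<rbrakk> \<Longrightarrow> (x, y) \<in> parcs G \<or> (y, x) \<in> parcs G"

definition source :: "'a pair_pre_digraph \<Rightarrow> 'a \<Rightarrow> bool" where
  "source G v \<longleftrightarrow> v \<in> pverts G \<and> in_degree (with_proj G) v = 0"

definition sink :: "'a pair_pre_digraph \<Rightarrow> 'a \<Rightarrow> bool" where
  "sink G v \<longleftrightarrow> v \<in> pverts G \<and> out_degree (with_proj G) v = 0"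

definition smooth :: "'a pair_pre_digraph \<Rightarrow> bool" where
  "smooth G \<longleftrightarrow> (\<nexists>v. source G v) \<and> (\<nexists>v. sink G v)"

text \<open>A library cycle is an arc list with a distinguished starting point, so the rotations of
  one directed cycle are different lists. Cycles are therefore compared by their arc sets.\<close>

definition more_than_one_cycle :: "'a pair_pre_digraph \<Rightarrow> bool" where
  "more_than_one_cycle G \<longleftrightarrow>
    (\<exists>c d. pre_digraph.cycle (with_proj G) c \<and> pre_digraph.cycle (with_proj G) d \<and> set c \<noteq> set d)"

text \<open>The new sink is \<open>None\<close>; an old vertex \<open>v\<close> becomes \<open>Some v\<close>. Hence the added sinks of
  different digraphs over the same vertex type are automatically identified.\<close>

definition add_sink :: "'a pair_pre_digraph \<Rightarrow> 'a option pair_pre_digraph" where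
  "add_sink G =
    \<lparr> pverts = insert None (Some ` pverts G),
      parcs = {(Some u, Some v) | u v. (u, v) \<in> parcs G} \<union> {(Some v, None) | v. v \<in> pverts G} \<rparr>"

text \<open>A \<open>k\<close>-tuple over \<open>V\<close> is an extensional function on \<open>{..<k}\<close>, and a \<open>k\<close>-ary operation on
  \<open>V\<close> is extensional on the set of these tuples, so that equality of operations is equality as
  maps from \<open>V\<^sup>k\<close> to \<open>V\<close>. Operations are paired with their arity.\<close>

definition id_Pol :: "'a pair_pre_digraph \<Rightarrow> (nat \<times> ((nat \<Rightarrow> 'a) \<Rightarrow> 'a)) set" where
  "id_Pol G = {(k, f). k \<ge> 1 \<and>
     f \<in> ({..<k} \<rightarrow>\<^sub>E pverts G) \<rightarrow>\<^sub>E pverts G \<and>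
     (\<forall>x \<in> {..<k} \<rightarrow>\<^sub>E pverts G. \<forall>y \<in> {..<k} \<rightarrow>\<^sub>E pverts G.
        (\<forall>i<k. (x i, y i) \<in> parcs G) \<longrightarrow> (f x, f y) \<in> parcs G) \<and>
     (\<forall>a \<in> pverts G. f (\<lambda>i\<in>{..<k}. a) = a)}"

text \<open>The arcs point from \<open>p\<close> and \<open>q\<close> to \<open>v\<close>: the out-neighbourhoods of \<open>p\<close> and \<open>q\<close> cover all
  vertices, which is why sources are excluded. With the arcs reversed, the property would fail
  for every digraph with a sink, in particular for every \<open>add_sink G\<close>; see the lemma below.\<close>

definition novi_sad :: "'a pair_pre_digraph \<Rightarrow> bool" where
  "novi_sad K \<longleftrightarrow> semicomplete_digraph K \<and> more_than_one_cycle K \<and> (\<nexists>v. source K v) \<and>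
     (\<exists>p \<in> pverts K. \<exists>q \<in> pverts K. \<forall>v \<in> pverts K. (p, v) \<in> parcs K \<or> (q, v) \<in> parcs K)"

lemma add_sink_no_reversed_cover:
  "\<not> (\<exists>p q. \<forall>v \<in> pverts (add_sink G). (v, p) \<in> parcs (add_sink G) \<or> (v, q) \<in> parcs (add_sink G))"
  by (auto simp: add_sink_def)

end

theory Submission imports Defs begin

text \<open>Every idempotent polymorphism of a smooth semicomplete digraph \<open>G\<close> with more than one cycle is a
  projection. A polymorphism of \<open>G\<^sup>+\<close> that restricts to the \<open>i\<close>-th projection sends a tuple
  with \<open>i\<close>-th entry \<open>v\<close> to the new sink or to a vertex \<open>w\<close> whose in-neighbourhood contains that of
  \<open>v\<close>. Hence it also preserves \<open>H\<^sup>+\<close>, where \<open>H\<close> has an arc from \<open>u\<close> to \<open>v\<close> unless the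
  in-neighbourhood of \<open>v\<close> is contained in that of \<open>u\<close>; a vertex with smallest in-neighbourhood and
  any of its in-neighbours then show the Novi Sad property.

  Projectivity is proved by induction on the number of vertices. If \<open>F u\<^sub>0 (w\<^sub>0)\<close> is an
  out-neighbour of \<open>u\<^sub>0\<close>, where \<open>u\<^sub>0\<close> is the argument at position \<open>i\<close> and \<open>w\<^sub>0\<close> the other ones, then
  along any walk \<open>w\<^sub>0, w\<^sub>1, \<dots>\<close> of tuples the values \<open>u\<^sub>n\<^sub>+\<^sub>1 = F u\<^sub>n (w\<^sub>n)\<close> form a
  walk; steering \<open>w\<^sub>n\<close> to a suitable tuple gives a contradiction. In this way a projection
  on one smooth subset spreads to a strong digraph. It remains to treat digraphs that are not strong, and
  strong ones in which every proper subuniverse has as its smooth part at most a cycle of length 2 or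
  3.\<close>

section \<open>Smooth, cyclic and acyclic sets of vertices\<close>

text \<open>Cycles of length 2 and 3 are the obstacle: on the integers modulo 2 or 3 the operation
  \<open>x - y + z\<close> is an idempotent polymorphism and no projection, so the induction cannot
  descend to them. What replaces a projection there is a tuple with two relevant positions. Each of
  these can be filled from outside the cycle independently of the other, and the arcs between the
  cycle and its surroundings turn this freedom into a contradiction. The arcs of \<open>H\<close>
  are dictated as well. A polymorphism can deviate from its projection only on tuples containing the
  sink, where \<open>v\<close> may be replaced by a vertex with a larger in-neighbourhood. A
  relation without loops that is stable under this replacement cannot contain \<open>(u, v)\<close>
  if the in-neighbourhood of \<open>v\<close> is contained in that of \<open>u\<close>, since
  \<open>v\<close> could be replaced by \<open>u\<close>; \<open>H\<close> consists of all remaining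
  pairs.\<close>

definition smooth_on :: "('a \<Rightarrow> 'a \<Rightarrow> bool) \<Rightarrow> 'a set \<Rightarrow> bool" where
  "smooth_on E S \<longleftrightarrow> (\<forall>v\<in>S. (\<exists>u\<in>S. E u v) \<and> (\<exists>w\<in>S. E v w))"

text \<open>In a semicomplete digraph, a cyclic set carries a directed cycle of length 2 or 3 without
  further arcs.\<close>

definition cyclic_on :: "('a \<Rightarrow> 'a \<Rightarrow> bool) \<Rightarrow> 'a set \<Rightarrow> bool" where
  "cyclic_on E S \<longleftrightarrow> S \<noteq> {} \<and> smooth_on E S \<and>
    (\<forall>x\<in>S. \<forall>y\<in>S. \<forall>z\<in>S. E x y \<and> E x z \<longrightarrow> y = z) \<and>
    (\<forall>x\<in>S. \<forall>y\<in>S. \<forall>z\<in>S. E y x \<and> E z x \<longrightarrow> y = z)"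

definition branching_on :: "('a \<Rightarrow> 'a \<Rightarrow> bool) \<Rightarrow> 'a set \<Rightarrow> bool" where
  "branching_on E S \<longleftrightarrow> S \<noteq> {} \<and> smooth_on E S \<and> \<not> cyclic_on E S"

text \<open>For finite sets this says that there is no closed walk; the form with smooth subsets is
  the one that compares directly with \<open>core_on\<close>.\<close>

definition acyclic_on :: "('a \<Rightarrow> 'a \<Rightarrow> bool) \<Rightarrow> 'a set \<Rightarrow> bool" where
  "acyclic_on E S \<longleftrightarrow> (\<forall>T\<subseteq>S. smooth_on E T \<longrightarrow> T = {})"

definition core_on :: "('a \<Rightarrow> 'a \<Rightarrow> bool) \<Rightarrow> 'a set \<Rightarrow> 'a set" where
  "core_on E S = \<Union>{T. T \<subseteq> S \<and> smooth_on E T}"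

definition proj_on :: "((nat \<Rightarrow> 'a) \<Rightarrow> 'a) \<Rightarrow> nat \<Rightarrow> 'a set \<Rightarrow> bool" where
  "proj_on F i S \<longleftrightarrow> (\<forall>x. (\<forall>j. x j \<in> S) \<longrightarrow> F x = x i)"

lemma smooth_on_converse: "smooth_on (\<lambda>x y. E y x) S = smooth_on E S"
  unfolding smooth_on_def by blast

lemma cyclic_on_converse: "cyclic_on (\<lambda>x y. E y x) S = cyclic_on E S"
  unfolding cyclic_on_def smooth_on_converse[of E] by blast

lemma branching_on_converse: "branching_on (\<lambda>x y. E y x) S = branching_on E S"
  unfolding branching_on_def smooth_on_converse[of E] cyclic_on_converse[of E] ..

lemma acyclic_on_converse: "acyclic_on (\<lambda>x y. E y x) S = acyclic_on E S"
  unfolding acyclic_on_def smooth_on_converse[of E] ..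

lemma smooth_on_Un: "smooth_on E S \<Longrightarrow> smooth_on E T \<Longrightarrow> smooth_on E (S \<union> T)"
  unfolding smooth_on_def by blast

lemma smooth_on_core: "smooth_on E (core_on E S)"
  unfolding smooth_on_def core_on_def by blast

lemma core_on_subset: "core_on E S \<subseteq> S"
  unfolding core_on_def by blast

lemma core_on_greatest: "T \<subseteq> S \<Longrightarrow> smooth_on E T \<Longrightarrow> T \<subseteq> core_on E S"
  unfolding core_on_def by blast

section \<open>Walks and closed walks\<close>

lemma smooth_on_walk_image:
  fixes p :: "nat \<Rightarrow> 'a"
  assumes "i < j" "p i = p j" "\<And>n. i \<le> n \<Longrightarrow> n < j \<Longrightarrow> E (p n) (p (Suc n))"
  shows "smooth_on E (p ` {i..j})"
proof -
  have "\<exists>u\<in>p ` {i..j}. E u (p n)" if "n \<in> {i..j}" for n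
  proof (cases "n = i")
    case True
    have "E (p (j - 1)) (p j)" "j - 1 \<in> {i..j}" using assms(3)[of "j - 1"] assms(1) by auto
    then show ?thesis using True assms(2) by (metis image_eqI)
  next
    case False
    then have "E (p (n - 1)) (p n)" "n - 1 \<in> {i..j}" using assms(3)[of "n - 1"] that by auto
    then show ?thesis by blast
  qed
  moreover have "\<exists>u\<in>p ` {i..j}. E (p n) u" if "n \<in> {i..j}" for n
  proof (cases "n = j")
    case True
    have "E (p i) (p (Suc i))" "Suc i \<in> {i..j}" using assms(3)[of i] assms(1) by auto
    then show ?thesis using True assms(2) by (metis image_eqI)
  next
    case False
    then have "E (p n) (p (Suc n))" "Suc n \<in> {i..j}" using assms(3)[of n] that by auto
    then show ?thesis by blast
  qed
  ultimately show ?thesis by (auto simp: smooth_on_def)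
qed

lemma acyclic_on_walk_bound:
  fixes p :: "nat \<Rightarrow> 'a"
  assumes "finite A" "acyclic_on E A" "\<And>i. i < n \<Longrightarrow> p i \<in> A"
    "\<And>i. Suc i < n \<Longrightarrow> E (p i) (p (Suc i))"
  shows "n \<le> card A"
proof (rule ccontr)
  assume "\<not> n \<le> card A"
  moreover have "p ` {..<n} \<subseteq> A" using assms(3) by auto
  ultimately have "card (p ` {..<n}) < card {..<n}"
    using card_mono[OF assms(1), of "p ` {..<n}"] by simp
  then have "\<not> inj_on p {..<n}" using pigeonhole by blast
  then obtain i j where ij: "i < j" "j < n" "p i = p j"
    by (metis inj_on_def lessThan_iff linorder_neqE_nat)
  then have "smooth_on E (p ` {i..j})" using assms(4) by (intro smooth_on_walk_image) auto
  moreover have "p ` {i..j} \<subseteq> A" using assms(3) ij(2) by auto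
  moreover have "p i \<in> p ` {i..j}" using ij(1) by simp
  ultimately show False using assms(2) unfolding acyclic_on_def by blast
qed

lemma acyclic_on_no_infinite_walk:
  assumes "finite A" "acyclic_on E A" "\<And>n. u n \<in> A" "\<And>n. E (u n) (u (Suc n))"
  shows False
proof -
  have "Suc (card A) \<le> card A"
    by (rule acyclic_on_walk_bound[of A E _ u]) (rule assms)+
  then show False by simp
qed

lemma smooth_on_infinite_walk:
  assumes "\<And>v. v \<in> S \<Longrightarrow> \<exists>w\<in>S. E v w" "s \<in> S"
  obtains u :: "nat \<Rightarrow> 'a" where "u 0 = s" "\<And>n. u n \<in> S" "\<And>n. E (u n) (u (Suc n))"
proof -
  obtain g where g: "\<And>v. v \<in> S \<Longrightarrow> g v \<in> S \<and> E v (g v)" using assms(1) by metis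
  define u where "u n = (g ^^ n) s" for n
  have S: "u n \<in> S" for n by (induction n) (use g assms(2) in \<open>auto simp: u_def\<close>)
  show ?thesis by (rule that[of u]) (use g S assms(2) in \<open>auto simp: u_def\<close>)
qed

lemma not_acyclic_if_sink_free:
  assumes "finite S" "S \<noteq> {}" "\<And>v. v \<in> S \<Longrightarrow> \<exists>w\<in>S. E v w"
  shows "\<not> acyclic_on E S"
proof
  assume a: "acyclic_on E S"
  obtain s where "s \<in> S" using assms(2) by blast
  then obtain u :: "nat \<Rightarrow> 'a" where "\<And>n. u n \<in> S" "\<And>n. E (u n) (u (Suc n))"
    using smooth_on_infinite_walk[of S E s] assms(3) by metis
  then show False using acyclic_on_no_infinite_walk[OF assms(1) a] by blast
qed

lemma not_acyclic_if_source_free: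
  assumes "finite S" "S \<noteq> {}" "\<And>v. v \<in> S \<Longrightarrow> \<exists>w\<in>S. E w v"
  shows "\<not> acyclic_on E S"
  using not_acyclic_if_sink_free[of S "\<lambda>x y. E y x"] assms
  unfolding acyclic_on_converse[of E] by blast

text \<open>The closed walk is a periodic sequence on all of \<open>nat\<close>, so that it can
  drive an infinite recursion.\<close>

lemma closed_walk_exists:
  assumes "finite S" "S \<noteq> {}" "smooth_on E S"
  obtains c :: "nat \<Rightarrow> 'a" and m where "m > 0" "\<And>n. c n \<in> S" "\<And>n. E (c n) (c (Suc n))"
    "\<And>n. c (n + m) = c n"
proof -
  obtain s where "s \<in> S" using assms(2) by blast
  then obtain u :: "nat \<Rightarrow> 'a" where u: "\<And>n. u n \<in> S" "\<And>n. E (u n) (u (Suc n))"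
    using smooth_on_infinite_walk[of S E s] assms(3) unfolding smooth_on_def by metis
  have "\<not> inj u" using finite_imageD[of u UNIV] finite_subset[of "range u" S] assms(1) u(1) by auto
  then obtain i j where ij: "i < j" "u i = u j" by (metis injI linorder_neqE_nat)
  define m where "m = j - i"
  define c where "c n = u (i + n mod m)" for n
  have m: "m > 0" "u (i + m) = u i" using ij by (auto simp: m_def)
  have "E (c n) (c (Suc n))" for n
  proof (cases "Suc (n mod m) = m")
    case True
    then have "c (Suc n) = u (i + m)" using m by (simp add: c_def mod_Suc)
    moreover have "Suc (i + n mod m) = i + m" using True by simp
    ultimately show ?thesis using u(2)[of "i + n mod m"] unfolding c_def by metis
  next
    case False
    then show ?thesis using u(2)[of "i + n mod m"] by (simp add: c_def mod_Suc)
  qed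
  then show ?thesis by (intro that[of m c]) (use m u in \<open>auto simp: c_def\<close>)
qed

lemma no_strict_chain:
  fixes A :: "nat \<Rightarrow> 'a set"
  assumes "finite V" "\<And>n. A n \<subseteq> V" "\<And>n. A n \<subset> A (Suc n)"
  shows False
proof -
  have "n \<le> card (A n)" for n
  proof (induction n)
    case (Suc n)
    have "card (A n) < card (A (Suc n))"
      using psubset_card_mono[OF finite_subset[OF assms(2) assms(1)] assms(3)] .
    then show ?case using Suc by simp
  qed simp
  then have "Suc (card V) \<le> card V" using card_mono[OF assms(1,2)] le_trans by blast
  then show False by simp
qed

text \<open>Every vertex has an in-neighbour, so the successor map is onto the finite set
  \<open>S\<close> and hence injective.\<close>

lemma cyclic_on_if_functional:
  assumes "finite S" "S \<noteq> {}" "smooth_on E S"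
    "\<And>x y z. x \<in> S \<Longrightarrow> y \<in> S \<Longrightarrow> z \<in> S \<Longrightarrow> E x y \<Longrightarrow> E x z \<Longrightarrow> y = z"
  shows "cyclic_on E S"
proof -
  obtain g where g: "\<And>v. v \<in> S \<Longrightarrow> g v \<in> S \<and> E v (g v)"
    using assms(3) unfolding smooth_on_def by metis
  have eq: "y = g x" if "x \<in> S" "y \<in> S" "E x y" for x y using assms(4) g that by blast
  have "S \<subseteq> g ` S" using assms(3) eq unfolding smooth_on_def by blast
  then have "inj_on g S" using assms(1) finite_surj_inj by blast
  then have "y = z" if "x \<in> S" "y \<in> S" "z \<in> S" "E y x" "E z x" for x y z
    using eq[of y x] eq[of z x] that \<open>inj_on g S\<close> by (auto simp: inj_on_def)
  then show ?thesis using assms unfolding cyclic_on_def by blast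
qed

lemma branching_on_two_out:
  assumes "finite S" "branching_on E S"
  obtains x y z where "x \<in> S" "y \<in> S" "z \<in> S" "E x y" "E x z" "y \<noteq> z"
  using cyclic_on_if_functional[of S E] assms unfolding branching_on_def by blast

lemma cyclic_on_succ:
  assumes "finite S" "cyclic_on E S"
  obtains \<sigma> where "bij_betw \<sigma> S S" "\<And>x y. x \<in> S \<Longrightarrow> y \<in> S \<Longrightarrow> E x y \<longleftrightarrow> y = \<sigma> x"
proof -
  obtain g where g: "\<And>v. v \<in> S \<Longrightarrow> g v \<in> S \<and> E v (g v)"
    using assms(2) unfolding cyclic_on_def smooth_on_def by metis
  have eq: "E x y \<longleftrightarrow> y = g x" if "x \<in> S" "y \<in> S" for x y
    using assms(2) g that unfolding cyclic_on_def by blast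
  have "S \<subseteq> g ` S" using assms(2) eq unfolding cyclic_on_def smooth_on_def by blast
  moreover have "inj_on g S" using calculation assms(1) finite_surj_inj by blast
  ultimately have "bij_betw g S S" using g by (auto simp: bij_betw_def)
  then show ?thesis using that eq by blast
qed

lemma proj_on_mono: "proj_on F i S \<Longrightarrow> T \<subseteq> S \<Longrightarrow> proj_on F i T"
  unfolding proj_on_def by blast

lemma periodic_mult:
  fixes c :: "nat \<Rightarrow> 'a"
  assumes "\<And>n. c (n + m) = c n"
  shows "c (r + n * m) = c r"
proof (induction n)
  case (Suc n)
  have "r + Suc n * m = (r + n * m) + m" by simp
  then show ?case using Suc assms by metis
qed simp

section \<open>Idempotent polymorphisms\<close>

text \<open>Tuples are functions on all of \<open>nat\<close>; that \<open>F\<close> has arity \<open>k\<close> is the condition that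
  \<open>F\<close> depends only on the first \<open>k\<close> entries. This spares bounds on the positions.\<close>

locale idempotent_polymorphism =
  fixes E :: "'a \<Rightarrow> 'a \<Rightarrow> bool" and V :: "'a set" and F :: "(nat \<Rightarrow> 'a) \<Rightarrow> 'a" and k :: nat
  assumes fin: "finite V" and irr: "\<not> E x x"
    and semi: "x \<in> V \<Longrightarrow> y \<in> V \<Longrightarrow> x \<noteq> y \<Longrightarrow> E x y \<or> E y x"
    and dom: "(\<And>j. X j \<in> V) \<Longrightarrow> F X \<in> V"
    and idem: "x \<in> V \<Longrightarrow> F (\<lambda>_. x) = x"
    and pol: "(\<And>j. X j \<in> V) \<Longrightarrow> (\<And>j. Y j \<in> V) \<Longrightarrow> (\<And>j. E (X j) (Y j)) \<Longrightarrow> E (F X) (F Y)"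
    and dep: "(\<And>j. j < k \<Longrightarrow> X j = Y j) \<Longrightarrow> F X = F Y"
begin

lemma converse: "idempotent_polymorphism (\<lambda>x y. E y x) V F k"
  by unfold_locales (use fin irr semi dom idem pol dep in blast)+

text \<open>Comparing \<open>x\<close> with the constant tuple of value \<open>F x\<close> would
  give a loop at \<open>F x\<close>.\<close>

lemma not_all_into_value:
  assumes "\<And>j. x j \<in> V" "\<And>j. E (x j) (F x)"
  shows False
proof -
  have "F x \<in> V" using dom assms(1) by blast
  then have "E (F x) (F (\<lambda>_. F x))" using pol[of x "\<lambda>_. F x"] assms by blast
  then show False using idem \<open>F x \<in> V\<close> irr by simp
qed

section \<open>Walks of values driven by walks of tuples\<close>

lemma forward_chain:
  fixes W :: "nat \<Rightarrow> nat \<Rightarrow> 'a"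
  assumes W: "\<And>n j. W n j \<in> V" "\<And>n j. E (W n j) (W (Suc n) j)"
    and u0: "u0 \<in> V" "E u0 (F ((W 0)(i := u0)))"
  obtains u where "u 0 = u0" "\<And>n. u n \<in> V" "\<And>n. u (Suc n) = F ((W n)(i := u n))"
    "\<And>n. E (u n) (u (Suc n))"
proof -
  define u where "u = rec_nat u0 (\<lambda>n v. F ((W n)(i := v)))"
  have u: "u 0 = u0" "\<And>n. u (Suc n) = F ((W n)(i := u n))" by (simp_all add: u_def)
  have V: "u n \<in> V" for n
  proof (induction n)
    case (Suc n)
    have "F ((W n)(i := u n)) \<in> V" by (rule dom) (use Suc W in auto)
    then show ?case by (simp add: u)
  qed (simp add: u u0)
  have "E (u n) (u (Suc n))" for n
  proof (induction n)
    case 0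
    then show ?case using u0 u by simp
  next
    case (Suc n)
    have "E (F ((W n)(i := u n))) (F ((W (Suc n))(i := u (Suc n))))"
      by (rule pol) (use Suc W V in auto)
    then show ?case using u(2) by metis
  qed
  then show ?thesis using that u V by blast
qed

text \<open>The walk \<open>u\<close> is driven by the diagonal tuples of \<open>c\<close>. If it is ever hit by an arc from
  \<open>c r\<close>, this persists, and then both entries of a later tuple dominate its value. Otherwise \<open>u\<close>
  stays strictly above the cycle, and the set of its in-neighbours above the cycle grows forever.\<close>

lemma diagonal_fixed_forward:
  assumes c: "\<And>n. c n \<in> V" "\<And>n. E (c n) (c (Suc n))" "m > 0" "\<And>n. c (n + m) = c n"
    and pr: "proj_on F i (range c)" and u0: "u0 \<in> V"
  shows "\<not> E u0 (F ((\<lambda>_. c 0)(i := u0)))"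
proof
  assume "E u0 (F ((\<lambda>_. c 0)(i := u0)))"
  then obtain u where u: "u 0 = u0" "\<And>n. u n \<in> V" "\<And>n. u (Suc n) = F ((\<lambda>_. c n)(i := u n))"
    "\<And>n. E (u n) (u (Suc n))"
    using forward_chain[of "\<lambda>n _. c n" u0 i] c u0 by metis
  have per: "c (r + n * m) = c r" for r n
    by (rule periodic_mult) (rule c(4))
  have into: "E (c r) (u (Suc n))" if "E (c r) (u n)" for r n
  proof -
    \<comment> \<open>\<open>c (n + (m - 1))\<close> is the predecessor of \<open>c n\<close> on the
      closed walk. Its diagonal with \<open>c r\<close> at position \<open>i\<close> is a tuple on
      which \<open>F\<close> is the projection, with value \<open>c r\<close>.\<close>
    have "E (c (n + (m - 1))) (c n)" using c(2)[of "n + (m - 1)"] c(3) c(4)[of n] by simp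
    then have "E (F ((\<lambda>_. c (n + (m - 1)))(i := c r))) (F ((\<lambda>_. c n)(i := u n)))"
      by (intro pol) (use that c u in auto)
    moreover have "F ((\<lambda>_. c (n + (m - 1)))(i := c r)) = c r"
      using pr[unfolded proj_on_def, rule_format, of "(\<lambda>_. c (n + (m - 1)))(i := c r)"] by simp
    ultimately show ?thesis using u(3) by simp
  qed
  show False
  proof (cases "\<exists>r n. E (c r) (u n)")
    case True
    then obtain r n where rn: "E (c r) (u n)" by blast
    have *: "E (c r) (u (n + d))" for d by (induction d) (use rn into in auto)
    \<comment> \<open>At time \<open>r + n * m\<close> the diagonal tuple consists of
      \<open>c r\<close> again, and the arc from \<open>c r\<close> has persisted until
      then.\<close>
    have "n \<le> r + n * m" using c(3) by (simp add: trans_le_add2)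
    then have "E (c r) (u (r + n * m))" using *[of "r + n * m - n"] by simp
    then have "E (c r) (u (Suc (r + n * m)))" by (rule into)
    then have "E (((\<lambda>_. c (r + n * m))(i := u (r + n * m))) j)
        (F ((\<lambda>_. c (r + n * m))(i := u (r + n * m))))" for j
      using u(4)[of "r + n * m"] u(3)[of "r + n * m"] per by auto
    then show False using not_all_into_value c(1) u(2) by (metis fun_upd_apply)
  next
    case False
    have out: "E (u n) (c r)" for n r
    proof -
      have "u n \<noteq> c r"
        using False c(2)[of "r + (m - 1)"] c(3) c(4)[of r] by (metis Suc_diff_1 add_Suc_right)
      then show ?thesis using semi u(2) c(1) False by blast
    qed
    define Z where "Z n = {z \<in> V. E z (u n) \<and> (\<forall>r. E z (c r))}" for n
    have "Z n \<subset> Z (Suc n)" for n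
    proof -
      have "E z (u (Suc n))" if "z \<in> Z n" for z
      proof -
        have "E (F (\<lambda>_. z)) (F ((\<lambda>_. c n)(i := u n)))"
          by (rule pol) (use that c u in \<open>auto simp: Z_def\<close>)
        then show ?thesis using that idem u(3) by (simp add: Z_def)
      qed
      moreover have "u n \<in> Z (Suc n)" using u out by (auto simp: Z_def)
      moreover have "u n \<notin> Z n" using irr by (auto simp: Z_def)
      ultimately show ?thesis by (auto simp: Z_def)
    qed
    then show False using no_strict_chain[OF fin, of Z] by (auto simp: Z_def)
  qed
qed

lemma diagonal_fixed:
  assumes c: "\<And>n. c n \<in> V" "\<And>n. E (c n) (c (Suc n))" "m > 0" "\<And>n. c (n + m) = c n"
    and pr: "proj_on F i (range c)" and u: "u \<in> V"
  shows "F ((\<lambda>_. c n)(i := u)) = u"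
proof (rule ccontr)
  let ?v = "F ((\<lambda>_. c n)(i := u))"
  assume "?v \<noteq> u"
  moreover have "?v \<in> V" by (rule dom) (use c u in auto)
  ultimately consider "E u ?v" | "E ?v u" using semi u by blast
  then show False
  proof cases
    case 1
    have "proj_on F i (range (\<lambda>r. c (n + r)))" by (rule proj_on_mono[OF pr]) auto
    then show False using diagonal_fixed_forward[of "\<lambda>r. c (n + r)" m i u] 1 c u
      by (auto simp flip: add.assoc)
  next
    case 2
    \<comment> \<open>Steps of \<open>m - 1\<close> modulo the period \<open>m\<close> traverse the
      closed walk backwards.\<close>
    define d where "d r = c (n + (m - 1) * r)" for r
    have per: "c (r + q * m) = c r" for r q
      by (rule periodic_mult) (rule c(4))
    have "E (d (Suc r)) (d r)" for r
    proof -
      have "Suc (n + (m - 1) * Suc r) = n + (m - 1) * r + m" using c(3) by simp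
      then show ?thesis using c(2)[of "n + (m - 1) * Suc r"] c(4)[of "n + (m - 1) * r"]
        unfolding d_def by metis
    qed
    moreover have "d (r + m) = d r" for r
      using per[of "n + (m - 1) * r" "m - 1"] by (simp only: d_def add_mult_distrib2 add.assoc)
    moreover have "proj_on F i (range d)" by (rule proj_on_mono[OF pr]) (auto simp: d_def)
    ultimately show False
      using idempotent_polymorphism.diagonal_fixed_forward[OF converse, of d m i u] 2 c u
      by (auto simp: d_def)
  qed
qed

lemma diagonal_fixed_smooth:
  assumes "X \<subseteq> V" "X \<noteq> {}" "smooth_on E X" "proj_on F i X"
  obtains b where "b \<in> X" "\<And>u. u \<in> V \<Longrightarrow> F ((\<lambda>_. b)(i := u)) = u"
proof -
  have "finite X" using assms(1) fin finite_subset by blast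
  then obtain c m where c: "m > 0" "\<And>n. c n \<in> X" "\<And>n. E (c n) (c (Suc n))" "\<And>n. c (n + m) = c n"
    using closed_walk_exists[of X E] assms by metis
  have "proj_on F i (range c)" by (rule proj_on_mono[OF assms(4)]) (use c in auto)
  then have "F ((\<lambda>_. c 0)(i := u)) = u" if "u \<in> V" for u
    using diagonal_fixed[of c m i u 0] c assms(1) that by blast
  then show ?thesis using that c(2) by blast
qed

end

section \<open>Spreading a projection from a smooth subset\<close>

definition arcs_on :: "('a \<Rightarrow> 'a \<Rightarrow> bool) \<Rightarrow> 'a set \<Rightarrow> ('a \<times> 'a) set" where
  "arcs_on E S = {(x, y). x \<in> S \<and> y \<in> S \<and> E x y}"

definition relevant :: "((nat \<Rightarrow> 'a) \<Rightarrow> 'a) \<Rightarrow> 'a set \<Rightarrow> nat \<Rightarrow> (nat \<Rightarrow> 'a) \<Rightarrow> bool" where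
  "relevant F S l y \<longleftrightarrow> (\<exists>s\<in>S. \<exists>t\<in>S. F (y(l := s)) \<noteq> F (y(l := t)))"

lemma relpow_loop: "(x, x) \<in> R ^^ n \<Longrightarrow> (x, x) \<in> R ^^ (a * n)"
  by (induction a) (auto intro: relpow_trans)

text \<open>The bound \<open>n * n\<close> makes the quotient \<open>q\<close> of \<open>m\<close>
  by \<open>n\<close> at least as large as the remainder \<open>r\<close>, so \<open>r\<close> of
  the \<open>q\<close> rounds can be replaced by rounds of length \<open>Suc n\<close>.\<close>

lemma relpow_loop_consecutive:
  assumes "(x, x) \<in> R ^^ n" "(x, x) \<in> R ^^ Suc n" "n > 0" "n * n \<le> m"
  shows "(x, x) \<in> R ^^ m"
proof -
  define q r where "q = m div n" and "r = m mod n"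
  have "n \<le> q" using assms(3,4) by (simp add: q_def less_eq_div_iff_mult_less_eq)
  then have "r \<le> q" using mod_less_divisor[OF assms(3), of m] by (simp add: r_def)
  have "m = q * n + r" by (simp add: q_def r_def)
  also have "\<dots> = (q - r) * n + r * Suc n"
    using \<open>r \<le> q\<close> by (metis (no_types, lifting) add.assoc add.commute add_mult_distrib le_add_diff_inverse mult_Suc_right)
  finally show ?thesis using relpow_trans relpow_loop assms(1,2) by metis
qed

context idempotent_polymorphism
begin

text \<open>A vertex \<open>x\<close> with out-neighbours \<open>y\<close> and \<open>z\<close>
  joined by an arc from \<open>z\<close> to \<open>y\<close> reaches \<open>y\<close> in one and in
  two steps, so it lies on closed walks of consecutive lengths.\<close>

lemma primitive_if_strong:
  assumes strong: "\<And>x y. x \<in> V \<Longrightarrow> y \<in> V \<Longrightarrow> (x, y) \<in> (arcs_on E V)\<^sup>*" and "branching_on E V"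
  obtains N where "\<And>x y. x \<in> V \<Longrightarrow> y \<in> V \<Longrightarrow> (x, y) \<in> arcs_on E V ^^ N"
proof -
  let ?R = "arcs_on E V"
  obtain x y z where xyz: "x \<in> V" "y \<in> V" "z \<in> V" "E x y" "E x z" "E z y"
    using branching_on_two_out[OF fin assms(2)] semi by metis
  then have R: "(x, y) \<in> ?R" "(x, z) \<in> ?R" "(z, y) \<in> ?R" by (auto simp: arcs_on_def)
  obtain p where p: "(y, x) \<in> ?R ^^ p" using strong xyz rtrancl_power by metis
  have n: "(x, x) \<in> ?R ^^ Suc p" "(x, x) \<in> ?R ^^ Suc (Suc p)"
    using R p by (metis relpow_Suc_I2)+
  have "\<exists>n. (u, v) \<in> ?R ^^ n" if "u \<in> V" "v \<in> V" for u v
    using strong[OF that] by (simp add: rtrancl_power)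
  then obtain g where g: "\<And>u v. u \<in> V \<Longrightarrow> v \<in> V \<Longrightarrow> (u, v) \<in> ?R ^^ g u v" by metis
  define d e where "d u = g u x" and "e u = g x u" for u
  have d: "(u, x) \<in> ?R ^^ d u" and e: "(x, u) \<in> ?R ^^ e u" if "u \<in> V" for u
    using g that xyz(1) by (auto simp: d_def e_def)
  \<comment> \<open>The maxima bound the lengths of the ways to and from \<open>x\<close>; the
    square guarantees that whatever length is left over can be filled by closed walks at
    \<open>x\<close>.\<close>
  define N where "N = Max (d ` V) + Suc p * Suc p + Max (e ` V)"
  have "(u, v) \<in> ?R ^^ N" if "u \<in> V" "v \<in> V" for u v
  proof -
    have le: "d u \<le> Max (d ` V)" "e v \<le> Max (e ` V)" using fin that by auto
    then have N: "Suc p * Suc p \<le> N - d u - e v" "d u + ((N - d u - e v) + e v) = N"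
      by (auto simp: N_def)
    have "(x, x) \<in> ?R ^^ (N - d u - e v)"
      by (rule relpow_loop_consecutive[OF n]) (use N in auto)
    from relpow_trans[OF d[OF that(1)] relpow_trans[OF this e[OF that(2)]]]
    show ?thesis unfolding N(2) .
  qed
  then show ?thesis using that by blast
qed

text \<open>The uniform length \<open>N\<close> lets all positions reach the diagonal of
  \<open>b\<close> at the same time. There the slice is the identity, so the walk of values would
  stand still at a loop.\<close>

lemma not_into_value_primitive:
  assumes N: "\<And>x y. x \<in> V \<Longrightarrow> y \<in> V \<Longrightarrow> (x, y) \<in> arcs_on E V ^^ N" and "smooth_on E V"
    and b: "b \<in> V" "\<And>u. u \<in> V \<Longrightarrow> F ((\<lambda>_. b)(i := u)) = u"
    and x: "\<And>j. x j \<in> V"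
  shows "\<not> E (x i) (F x)"
proof
  assume E: "E (x i) (F x)"
  have "\<exists>p. p 0 = x j \<and> p N = b \<and> (\<forall>n<N. (p n, p (Suc n)) \<in> arcs_on E V)" for j
    using N[OF x b(1)] relpow_fun_conv[of "x j" b N] by auto
  then obtain p where p: "\<And>j. p j 0 = x j" "\<And>j. p j N = b"
    "\<And>j n. n < N \<Longrightarrow> (p j n, p j (Suc n)) \<in> arcs_on E V" by metis
  have "\<And>v. v \<in> V \<Longrightarrow> \<exists>w\<in>V. E v w" using assms(2) by (auto simp: smooth_on_def)
  then obtain c :: "nat \<Rightarrow> 'a" where c: "c 0 = b" "\<And>n. c n \<in> V" "\<And>n. E (c n) (c (Suc n))"
    using smooth_on_infinite_walk[of V E b] b(1) by metis
  \<comment> \<open>Past time \<open>N\<close> the tuples follow a walk from \<open>b\<close>, since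
    \<open>forward_chain\<close> drives the recursion by an infinite walk.\<close>
  define W where "W n j = (if n \<le> N then p j n else c (n - N))" for n j
  have pV: "p j n \<in> V" if "n \<le> N" for j n
    using p(3)[of n j] p(2)[of j] b(1) that by (cases "n = N") (auto simp: arcs_on_def)
  have W: "W n j \<in> V" "E (W n j) (W (Suc n) j)" for n j
  proof -
    show "W n j \<in> V" using pV c by (auto simp: W_def)
    consider "n < N" | "n = N" | "n > N" by linarith
    then show "E (W n j) (W (Suc n) j)"
    proof cases
      case 1
      then show ?thesis using p(3)[of n j] by (auto simp: W_def arcs_on_def)
    next
      case 2
      then show ?thesis using p(2) c(1) c(3)[of 0] by (auto simp: W_def)
    next
      case 3
      then show ?thesis using c(3)[of "n - N"] by (auto simp: W_def Suc_diff_le)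
    qed
  qed
  have "(W 0)(i := x i) = x" using p(1) by (auto simp: W_def)
  then obtain u where u: "\<And>n. u n \<in> V" "\<And>n. u (Suc n) = F ((W n)(i := u n))"
    "\<And>n. E (u n) (u (Suc n))"
    using forward_chain[of W "x i" i] W x E by metis
  have "W N = (\<lambda>_. b)" using p(2) by (auto simp: W_def)
  then have "u (Suc N) = u N" using b(2) u(1,2) by metis
  then show False using u(3)[of N] irr by simp
qed

text \<open>One vertex \<open>b\<close> with identity slice serves both the digraph and its
  converse, so there is no arc between \<open>x i\<close> and \<open>F x\<close> in either
  direction.\<close>

lemma proj_on_if_strong:
  assumes strong: "\<And>x y. x \<in> V \<Longrightarrow> y \<in> V \<Longrightarrow> (x, y) \<in> (arcs_on E V)\<^sup>*" and "branching_on E V"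
    and X: "X \<subseteq> V" "X \<noteq> {}" "smooth_on E X" "proj_on F i X"
  shows "proj_on F i V"
  unfolding proj_on_def
proof (intro allI impI)
  fix x :: "nat \<Rightarrow> 'a" assume x: "\<forall>j. x j \<in> V"
  interpret dual: idempotent_polymorphism "\<lambda>x y. E y x" V F k by (rule converse)
  obtain b where b: "b \<in> X" "\<And>u. u \<in> V \<Longrightarrow> F ((\<lambda>_. b)(i := u)) = u"
    using diagonal_fixed_smooth[OF X] by blast
  obtain N where N: "\<And>x y. x \<in> V \<Longrightarrow> y \<in> V \<Longrightarrow> (x, y) \<in> arcs_on E V ^^ N"
    using primitive_if_strong[OF strong assms(2)] by blast
  have "(x, y) \<in> arcs_on (\<lambda>x y. E y x) V ^^ N" if xy: "x \<in> V" "y \<in> V" for x y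
  proof -
    obtain p where p: "p 0 = y" "p N = x" "\<And>n. n < N \<Longrightarrow> (p n, p (Suc n)) \<in> arcs_on E V"
      using N[OF xy(2,1)] relpow_fun_conv[of y x N] by auto
    have "(p (N - n), p (N - Suc n)) \<in> arcs_on (\<lambda>x y. E y x) V" if "n < N" for n
      using p(3)[of "N - Suc n"] that by (auto simp: arcs_on_def Suc_diff_Suc)
    then show ?thesis unfolding relpow_fun_conv using p by (intro exI[of _ "\<lambda>n. p (N - n)"]) auto
  qed
  moreover have sm: "smooth_on E V" "smooth_on (\<lambda>x y. E y x) V"
    using assms(2) unfolding branching_on_def smooth_on_converse[of E] by auto
  ultimately have "\<not> E (F x) (x i)"
    using dual.not_into_value_primitive[of N b i x] b X(1) x by blast
  moreover have "\<not> E (x i) (F x)" using not_into_value_primitive[of N b i x] N sm b X(1) x by blast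
  ultimately show "F x = x i" using semi dom x by blast
qed

text \<open>After one step the moving entries lie in \<open>J\<close> and are dominated by
  \<open>b\<close>. As the slice at \<open>b\<close> is the identity, in-neighbours of the current
  value stay in-neighbours of the next one, which the current value joins: endless strict
  growth.\<close>

lemma not_into_value_split:
  assumes IJ: "V = I \<union> J" "\<And>x y. x \<in> J \<Longrightarrow> y \<in> I \<Longrightarrow> \<not> E x y" "I \<inter> J = {}" "J \<noteq> {}" and "smooth_on E V"
    and b: "b \<in> I" "\<And>u. u \<in> V \<Longrightarrow> F ((\<lambda>_. b)(i := u)) = u"
    and x: "\<And>j. x j \<in> V"
  shows "\<not> E (x i) (F x)"
proof
  assume E: "E (x i) (F x)"
  have IJ_arc: "E v w" if "v \<in> I" "w \<in> J" for v w
    using semi[of v w] IJ that by auto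
  have "\<exists>w\<in>J. E v w" if "v \<in> V" for v
    using IJ IJ_arc assms(5) that unfolding smooth_on_def by blast
  then obtain s where s: "\<And>v. v \<in> V \<Longrightarrow> s v \<in> J \<and> E v (s v)" by metis
  have "b \<in> V" using IJ(1) b(1) by simp
  define W where "W n j = (s ^^ n) (x j)" for n j
  have WV: "W n j \<in> V" for n j by (induction n) (use x s IJ(1) in \<open>auto simp: W_def\<close>)
  have W: "E (W n j) (W (Suc n) j)" "W (Suc n) j \<in> J" for n j
    using WV s by (auto simp: W_def)
  have "(W 0)(i := x i) = x" by (auto simp: W_def)
  then obtain u where u: "\<And>n. u n \<in> V" "\<And>n. u (Suc n) = F ((W n)(i := u n))"
    "\<And>n. E (u n) (u (Suc n))"
    using forward_chain[of W "x i" i] WV W x E by metis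
  \<comment> \<open>The index is shifted because only from time 1 on do all entries of the tuple lie
    in \<open>J\<close>.\<close>
  define Z where "Z n = {z \<in> V. E z (u (Suc n))}" for n
  have "Z n \<subset> Z (Suc n)" for n
  proof -
    have "E z (u (Suc (Suc n)))" if "z \<in> Z n" for z
    proof -
      have "E b (W (Suc n) j)" for j using IJ_arc[OF b(1) W(2)] .
      then have "E (F ((\<lambda>_. b)(i := z))) (F ((W (Suc n))(i := u (Suc n))))"
        by (intro pol) (use that \<open>b \<in> V\<close> WV u(1) in \<open>auto simp: Z_def\<close>)
      then show ?thesis using that b u(2) by (simp add: Z_def)
    qed
    moreover have "u (Suc n) \<in> Z (Suc n)" using u(1,3) by (simp add: Z_def)
    moreover have "u (Suc n) \<notin> Z n" using irr by (auto simp: Z_def)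
    ultimately show ?thesis by (auto simp: Z_def)
  qed
  then show False using no_strict_chain[OF fin, of Z] by (auto simp: Z_def)
qed

text \<open>The projection on the dominating side excludes an arc from \<open>x i\<close> to
  \<open>F x\<close>, the one on the dominated side the opposite arc.\<close>

lemma proj_on_if_split:
  assumes IJ: "V = I \<union> J" "\<And>x y. x \<in> J \<Longrightarrow> y \<in> I \<Longrightarrow> \<not> E x y" "I \<inter> J = {}" and "smooth_on E V"
    and X: "X \<subseteq> I" "X \<noteq> {}" "smooth_on E X" "proj_on F i X"
    and Y: "Y \<subseteq> J" "Y \<noteq> {}" "smooth_on E Y" "proj_on F i Y"
  shows "proj_on F i V"
  unfolding proj_on_def
proof (intro allI impI)
  fix x :: "nat \<Rightarrow> 'a" assume x: "\<forall>j. x j \<in> V"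
  interpret dual: idempotent_polymorphism "\<lambda>x y. E y x" V F k by (rule converse)
  have sub: "X \<subseteq> V" "Y \<subseteq> V" and ne: "I \<noteq> {}" "J \<noteq> {}" using IJ X Y by auto
  obtain a where a: "a \<in> X" "\<And>u. u \<in> V \<Longrightarrow> F ((\<lambda>_. a)(i := u)) = u"
    using diagonal_fixed_smooth[OF sub(1) X(2-)] by blast
  obtain b where b: "b \<in> Y" "\<And>u. u \<in> V \<Longrightarrow> F ((\<lambda>_. b)(i := u)) = u"
    using diagonal_fixed_smooth[OF sub(2) Y(2-)] by blast
  have "\<not> E (x i) (F x)"
    using not_into_value_split[of I J a i x] assms(4) IJ X(1) ne a x by blast
  moreover have "smooth_on (\<lambda>x y. E y x) V" using assms(4) smooth_on_converse[of E] by blast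
  then have "\<not> E (F x) (x i)"
    using dual.not_into_value_split[of J I b i x] IJ Y(1) ne b x by blast
  ultimately show "F x = x i" using semi dom x by blast
qed

text \<open>If no tuple has two relevant positions, changing a position other than a relevant \<open>l\<close> never
  changes the unary function at position \<open>l\<close>.\<close>

lemma proj_or_two_relevant:
  assumes "S \<subseteq> V" "\<And>i. \<not> proj_on F i S"
  obtains y l l' where "\<And>j. y j \<in> S" "l \<noteq> l'" "relevant F S l y" "relevant F S l' y"
proof (rule ccontr)
  assume "\<not> thesis"
  then have one: "l = l'" if "\<And>j. y j \<in> S" "relevant F S l y" "relevant F S l' y" for y l l'
    using that \<open>\<And>l l' y. \<lbrakk>\<And>j. y j \<in> S; l \<noteq> l'; relevant F S l y; relevant F S l' y\<rbrakk> \<Longrightarrow> thesis\<close> by blast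
  obtain s0 where s0: "s0 \<in> S" using assms(2)[of 0] by (auto simp: proj_on_def)
  have upd: "relevant F S l (y(l := s)) = relevant F S l y" for l y s
    by (simp add: relevant_def)
  obtain y l where y: "\<And>j. y j \<in> S" and
    yl: "\<And>z n s. (\<And>j. z j \<in> S) \<Longrightarrow> n \<noteq> l \<Longrightarrow> (\<And>s. s \<in> S \<Longrightarrow> F (z(l := s)) = F (y(l := s))) \<Longrightarrow>
      s \<in> S \<Longrightarrow> \<not> relevant F S n (z(l := s))"
  proof (cases "\<exists>y l. (\<forall>j. y j \<in> S) \<and> relevant F S l y")
    case False
    \<comment> \<open>No position is relevant at any tuple, so any tuple and any position will
      do.\<close>
    show thesis
    proof (rule that[of "\<lambda>_. s0" 0])
      fix z :: "nat \<Rightarrow> 'a" and n s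
      assume "\<And>j. z j \<in> S" "s \<in> S"
      then have "\<forall>j. (z(0 := s)) j \<in> S" by simp
      then show "\<not> relevant F S n (z(0 := s))" using False by blast
    qed (rule s0)
  next
    case True
    then obtain y l where yl: "\<And>j. y j \<in> S" "relevant F S l y" by blast
    show thesis
    proof (rule that[of y l])
      fix z n s
      assume z: "\<And>j. z j \<in> S" "n \<noteq> l" "\<And>s. s \<in> S \<Longrightarrow> F (z(l := s)) = F (y(l := s))" "s \<in> S"
      then have "relevant F S l z" using yl(2) by (auto simp: relevant_def)
      then have "relevant F S l (z(l := s))" by (simp add: upd)
      moreover have "\<And>j. (z(l := s)) j \<in> S" using z by auto
      ultimately show "\<not> relevant F S n (z(l := s))" using one z(2) by blast
    qed (rule yl(1))
  qed
  have slice: "F z = F (y(l := z l))" if z: "\<And>j. z j \<in> S" for z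
  proof -
    \<comment> \<open>The entries of \<open>z\<close> replace those of \<open>y\<close> one at a
      time; after \<open>k\<close> replacements \<open>dep\<close> identifies the value with that of
      \<open>z\<close>.\<close>
    define Z where "Z n j = (if j < n then z j else y j)" for n j
    have ZS: "Z n j \<in> S" for n j using z y by (simp add: Z_def)
    have "\<forall>s\<in>S. F ((Z n)(l := s)) = F (y(l := s))" for n
    proof (induction n)
      case 0
      have "Z 0 = y" by (auto simp: Z_def)
      then show ?case by simp
    next
      case (Suc n)
      have Z: "Z (Suc n) = (Z n)(n := z n)" by (auto simp: Z_def)
      show ?case
      proof
        fix s assume s: "s \<in> S"
        show "F ((Z (Suc n))(l := s)) = F (y(l := s))"
        proof (cases "n = l")
          case True
          then have "(Z (Suc n))(l := s) = (Z n)(l := s)" using Z by simp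
          then show ?thesis using Suc s by metis
        next
          case False
          have "\<not> relevant F S n ((Z n)(l := s))" using yl[of "Z n" n s] ZS False Suc s by blast
          then have "F ((Z n)(l := s, n := z n)) = F ((Z n)(l := s, n := Z n n))"
            unfolding relevant_def using z ZS by blast
          moreover have "(Z n)(l := s, n := Z n n) = (Z n)(l := s)" using False by auto
          moreover have "(Z (Suc n))(l := s) = (Z n)(l := s, n := z n)"
            using Z False by (simp add: fun_upd_twist)
          ultimately show ?thesis using Suc s by metis
        qed
      qed
    qed
    then have "F ((Z k)(l := z l)) = F (y(l := z l))" using z by blast
    moreover have "F ((Z k)(l := z l)) = F z" by (rule dep) (auto simp: Z_def)
    ultimately show ?thesis by simp
  qed
  \<comment> \<open>Constant tuples have the same slice, and by idempotence they show it to be the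
    identity.\<close>
  have "F z = z l" if z: "\<And>j. z j \<in> S" for z
    using slice[OF z] slice[of "\<lambda>_. z l"] idem[of "z l"] z assms(1) by auto
  then show False using assms(2)[of l] by (auto simp: proj_on_def)
qed

section \<open>Subuniverses\<close>

definition subuniverse :: "'a set \<Rightarrow> bool" where
  "subuniverse S \<longleftrightarrow> S \<subseteq> V \<and> (\<forall>x. (\<forall>j. x j \<in> S) \<longrightarrow> F x \<in> S)"

lemma subuniverse_subset: "subuniverse S \<Longrightarrow> S \<subseteq> V"
  by (simp add: subuniverse_def)

lemma subuniverse_F: "subuniverse S \<Longrightarrow> (\<And>j. x j \<in> S) \<Longrightarrow> F x \<in> S"
  by (simp add: subuniverse_def)

lemma subuniverse_idempotent_polymorphism:
  assumes "subuniverse S"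
  shows "idempotent_polymorphism E S F k"
proof unfold_locales
  have sub: "S \<subseteq> V" using assms by (rule subuniverse_subset)
  show "finite S" using sub fin by (rule finite_subset)
  show "\<not> E x x" for x by (rule irr)
  show "E x y \<or> E y x" if "x \<in> S" "y \<in> S" "x \<noteq> y" for x y using semi sub that by blast
  show "F X \<in> S" if "\<And>j. X j \<in> S" for X using subuniverse_F assms that by blast
  show "F (\<lambda>_. x) = x" if "x \<in> S" for x using idem sub that by blast
  show "E (F X) (F Y)" if "\<And>j. X j \<in> S" "\<And>j. Y j \<in> S" "\<And>j. E (X j) (Y j)" for X Y
    by (rule pol) (use sub that in blast)+
  show "F X = F Y" if "\<And>j. j < k \<Longrightarrow> X j = Y j" for X Y by (rule dep) (rule that)
qed

lemma subuniverse_singleton: "a \<in> V \<Longrightarrow> subuniverse {a}"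
proof -
  assume a: "a \<in> V"
  have "F x = a" if "\<forall>j. x j = a" for x :: "nat \<Rightarrow> 'a"
  proof -
    have "x = (\<lambda>_. a)" using that by auto
    then show ?thesis using idem[OF a] by simp
  qed
  then show ?thesis using a by (simp add: subuniverse_def)
qed

lemma subuniverse_Int: "subuniverse S \<Longrightarrow> subuniverse T \<Longrightarrow> subuniverse (S \<inter> T)"
  by (auto simp: subuniverse_def)

lemma subuniverse_out:
  assumes "subuniverse S"
  shows "subuniverse {y \<in> V. \<exists>x\<in>S. E x y}"
  unfolding subuniverse_def
proof (intro conjI allI impI)
  fix y :: "nat \<Rightarrow> 'a" assume y: "\<forall>j. y j \<in> {y \<in> V. \<exists>x\<in>S. E x y}"
  then obtain x where x: "\<And>j. x j \<in> S" "\<And>j. E (x j) (y j)" by (auto) metis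
  have "E (F x) (F y)" by (rule pol) (use x y subuniverse_subset[OF assms] in auto)
  then show "F y \<in> {y \<in> V. \<exists>x\<in>S. E x y}" using subuniverse_F[OF assms x(1)] dom y by auto
qed auto

lemma subuniverse_in:
  assumes "subuniverse S"
  shows "subuniverse {y \<in> V. \<exists>x\<in>S. E y x}"
  using idempotent_polymorphism.subuniverse_out[OF converse, of S] assms by simp

text \<open>Entrywise in- and out-neighbours inside the core show that the values on tuples from the
  core form a smooth set, so they belong to the largest one.\<close>

lemma subuniverse_core:
  assumes "subuniverse S"
  shows "subuniverse (core_on E S)"
proof -
  let ?C = "core_on E S"
  let ?T = "F ` {x. \<forall>j. x j \<in> ?C}"
  have CV: "?C \<subseteq> V" using core_on_subset[of E S] subuniverse_subset[OF assms] by (rule order.trans)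
  have "(\<exists>u\<in>?T. E u (F x)) \<and> (\<exists>u\<in>?T. E (F x) u)" if x: "\<forall>j. x j \<in> ?C" for x :: "nat \<Rightarrow> 'a"
  proof -
    have "\<forall>j. \<exists>u\<in>?C. E u (x j)" "\<forall>j. \<exists>u\<in>?C. E (x j) u"
      using smooth_on_core[of E S] x by (auto simp: smooth_on_def)
    then obtain p q where p: "\<And>j. p j \<in> ?C" "\<And>j. E (p j) (x j)"
      and q: "\<And>j. q j \<in> ?C" "\<And>j. E (x j) (q j)" by metis
    have "E (F p) (F x)" by (rule pol) (use p x CV in auto)
    moreover have "E (F x) (F q)" by (rule pol) (use q x CV in auto)
    ultimately show ?thesis using p(1) q(1) by blast
  qed
  then have "smooth_on E ?T" by (auto simp: smooth_on_def)
  moreover have "?T \<subseteq> S" using core_on_subset[of E S] subuniverse_F[OF assms] by blast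
  ultimately have "?T \<subseteq> ?C" by (rule core_on_greatest[rotated])
  then show ?thesis using CV by (auto simp: subuniverse_def)
qed

text \<open>A value outside \<open>I\<close> would receive arcs from all entries of its
  tuple.\<close>

lemma subuniverse_if_dominating:
  assumes "I \<subseteq> V" "\<And>x y. x \<in> I \<Longrightarrow> y \<in> V - I \<Longrightarrow> E x y"
  shows "subuniverse I"
  unfolding subuniverse_def
proof (intro conjI allI impI assms(1))
  fix x :: "nat \<Rightarrow> 'a" assume x: "\<forall>j. x j \<in> I"
  show "F x \<in> I"
  proof (rule ccontr)
    assume "F x \<notin> I"
    then have "\<And>j. E (x j) (F x)" using x assms dom by blast
    then show False using not_all_into_value[of x] x assms(1) by blast
  qed
qed

end

section \<open>Polymorphisms on a short cycle\<close>

text \<open>\<open>n\<close> counts vertices, not arcs: a walk with \<open>Suc n\<close> vertices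
  ends in \<open>p n\<close>, and 0 is always possible.\<close>

definition walk_in :: "('a \<Rightarrow> 'a \<Rightarrow> bool) \<Rightarrow> 'a set \<Rightarrow> (nat \<Rightarrow> 'a) \<Rightarrow> nat \<Rightarrow> bool" where
  "walk_in E A p n \<longleftrightarrow> (\<forall>i<n. p i \<in> A) \<and> (\<forall>i. Suc i < n \<longrightarrow> E (p i) (p (Suc i)))"

definition walk_length :: "('a \<Rightarrow> 'a \<Rightarrow> bool) \<Rightarrow> 'a set \<Rightarrow> nat" where
  "walk_length E A = Max {n. \<exists>p. walk_in E A p n}"

lemma walk_length:
  assumes "finite A" "acyclic_on E A"
  shows walk_length_walk: "\<exists>p. walk_in E A p (walk_length E A)"
    and walk_length_max: "\<And>p n. walk_in E A p n \<Longrightarrow> n \<le> walk_length E A"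
proof -
  let ?L = "{n. \<exists>p. walk_in E A p n}"
  have "n \<le> card A" if "walk_in E A p n" for p n
    by (rule acyclic_on_walk_bound[OF assms, of n p]) (use that in \<open>simp_all add: walk_in_def\<close>)
  then have fin: "finite ?L" by (auto intro: finite_subset[of _ "{..card A}"])
  moreover have "0 \<in> ?L" by (simp add: walk_in_def)
  ultimately have "Max ?L \<in> ?L" by (intro Max_in) auto
  then show "\<exists>p. walk_in E A p (walk_length E A)" by (simp add: walk_length_def)
  show "n \<le> walk_length E A" if "walk_in E A p n" for p n
    unfolding walk_length_def using fin that by (intro Max_ge) auto
qed

lemma walk_length_pos:
  assumes "finite A" "acyclic_on E A" "a \<in> A"
  shows "walk_length E A > 0"
proof -
  have "walk_in E A (\<lambda>_. a) 1" using assms(3) by (simp add: walk_in_def)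
  then show ?thesis using walk_length_max[OF assms(1,2)] by fastforce
qed

lemma longest_walk_last:
  assumes "finite A" "acyclic_on E A" "walk_in E A p (Suc n)" "walk_length E A = Suc n" "w \<in> A"
  shows "\<not> E (p n) w"
proof
  assume "E (p n) w"
  then have "walk_in E A (p(Suc n := w)) (Suc (Suc n))"
    using assms(3,5) by (auto simp: walk_in_def less_Suc_eq)
  then show False using walk_length_max[OF assms(1,2)] assms(4) by fastforce
qed

lemma longest_walk_first:
  assumes "finite A" "acyclic_on E A" "walk_in E A p (walk_length E A)" "w \<in> A"
  shows "\<not> E w (p 0)"
proof
  assume "E w (p 0)"
  then have "walk_in E A (case_nat w p) (Suc (walk_length E A))"
    using assms(3,4) by (auto simp: walk_in_def split: nat.split)
  then show False using walk_length_max[OF assms(1,2)] by fastforce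
qed

lemma permutation_mono_eq:
  fixes d :: "'a \<Rightarrow> nat"
  assumes "finite S" "bij_betw g S S" "\<And>e. e \<in> S \<Longrightarrow> d e \<le> d (g e)" "e \<in> S"
  shows "d (g e) = d e"
proof (rule ccontr)
  assume "d (g e) \<noteq> d e"
  then have "sum d S < sum (\<lambda>e. d (g e)) S"
    by (intro sum_strict_mono_ex1) (use assms in \<open>auto intro: bexI[of _ e] simp: nat_less_le\<close>)
  then show False using sum.reindex_bij_betw[OF assms(2), of d] by simp
qed

lemma cyclic_on_subset:
  "cyclic_on E S \<Longrightarrow> T \<subseteq> S \<Longrightarrow> T \<noteq> {} \<Longrightarrow> smooth_on E T \<Longrightarrow> cyclic_on E T"
  unfolding cyclic_on_def by (intro conjI) (assumption, assumption, blast, blast)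

context idempotent_polymorphism
begin

text \<open>Vertices of \<open>S\<close> have their only out-neighbour inside \<open>S\<close>, so a
  vertex \<open>c\<close> of \<open>C\<close> outside \<open>S\<close> sends arcs to all of
  \<open>S\<close>. Having one out-neighbour itself, it forces \<open>S\<close> to be a single
  vertex with a loop.\<close>

lemma cyclic_on_maximal:
  assumes "cyclic_on E S" "cyclic_on E C" "S \<subseteq> C" "C \<subseteq> V"
  shows "S = C"
proof (rule ccontr)
  assume "S \<noteq> C"
  then obtain c where c: "c \<in> C" "c \<notin> S" using assms(3) by blast
  have out: "E c s" if "s \<in> S" for s
  proof -
    obtain t where "t \<in> S" "E s t" using assms(1) \<open>s \<in> S\<close> unfolding cyclic_on_def smooth_on_def by blast
    then have "\<not> E s c" using assms(2,3) c \<open>s \<in> S\<close> unfolding cyclic_on_def by blast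
    then show ?thesis using semi[of c s] c assms(3,4) that by blast
  qed
  obtain s t where st: "s \<in> S" "t \<in> S" "E s t"
    using assms(1) unfolding cyclic_on_def smooth_on_def by blast
  then have "s = t" using out[of s] out[of t] assms(2,3) c(1) unfolding cyclic_on_def by blast
  then show False using st irr by blast
qed

lemma cyclic_on_smooth_subset:
  assumes "cyclic_on E S" "S \<subseteq> V" "T \<subseteq> S" "T \<noteq> {}" "smooth_on E T"
  shows "T = S"
  using cyclic_on_maximal[OF cyclic_on_subset[OF assms(1,3,4,5)] assms(1,3,2)] .

end

section \<open>Rotations of a cyclic subuniverse\<close>

locale cyclic_set = idempotent_polymorphism +
  fixes S :: "'a set" and \<sigma> :: "'a \<Rightarrow> 'a"
  assumes subuniverse_S: "subuniverse S" and cyclic_S: "cyclic_on E S" and bij: "bij_betw \<sigma> S S"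
    and arc: "x \<in> S \<Longrightarrow> y \<in> S \<Longrightarrow> E x y \<longleftrightarrow> y = \<sigma> x"
begin

lemma S_V: "x \<in> S \<Longrightarrow> x \<in> V"
  using subuniverse_subset[OF subuniverse_S] by blast

lemma finite_S: "finite S"
  by (rule finite_subset[OF subuniverse_subset[OF subuniverse_S] fin])

lemma \<sigma>_S: "x \<in> S \<Longrightarrow> \<sigma> x \<in> S"
  using bij bij_betwE by blast

lemma \<sigma>_inj: "x \<in> S \<Longrightarrow> y \<in> S \<Longrightarrow> \<sigma> x = \<sigma> y \<Longrightarrow> x = y"
  using bij by (auto simp: bij_betw_def inj_on_def)

lemma \<sigma>_surj: "y \<in> S \<Longrightarrow> \<exists>x\<in>S. y = \<sigma> x"
  using bij by (auto simp: bij_betw_def)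

lemma \<sigma>_neq: "x \<in> S \<Longrightarrow> \<sigma> x \<noteq> x"
  using arc[of x x] irr by metis

lemma \<sigma>_pow_S: "x \<in> S \<Longrightarrow> (\<sigma> ^^ n) x \<in> S"
  by (induction n) (auto intro: \<sigma>_S)

lemma \<sigma>_pow_surj: "y \<in> S \<Longrightarrow> \<exists>x\<in>S. y = (\<sigma> ^^ n) x"
proof (induction n arbitrary: y)
  case (Suc n)
  obtain z where "z \<in> S" "y = \<sigma> z" using \<sigma>_surj[OF Suc.prems] by blast
  then show ?case using Suc.IH[of z] by auto
qed auto

text \<open>\<open>\<sigma>\<close> permutes the finite set \<open>T\<close>, which is therefore
  smooth. Semicompleteness enters through \<open>cyclic_on_smooth_subset\<close> and excludes
  several disjoint cycles.\<close>

lemma \<sigma>_invariant: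
  assumes "T \<subseteq> S" "T \<noteq> {}" "\<sigma> ` T \<subseteq> T"
  shows "T = S"
proof (rule cyclic_on_smooth_subset[OF cyclic_S subuniverse_subset[OF subuniverse_S] assms(1,2)])
  have "finite T" by (rule finite_subset[OF assms(1) finite_S])
  moreover have "inj_on \<sigma> T" using \<sigma>_inj assms(1) unfolding inj_on_def by blast
  ultimately have "\<sigma> ` T = T" using endo_inj_surj assms(3) by blast
  then show "smooth_on E T" using assms(1) arc unfolding smooth_on_def by blast
qed

text \<open>Arbitrarily large exponents are provided so that a whole walk of values fits in before
  time \<open>n\<close>.\<close>

lemma \<sigma>_orbit:
  assumes "x \<in> S" "y \<in> S"
  obtains n where "n \<ge> m" "(\<sigma> ^^ n) x = y"
proof -
  have "{(\<sigma> ^^ n) x | n. n \<ge> m} = S"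
  proof (rule \<sigma>_invariant)
    have "\<sigma> ((\<sigma> ^^ n) x) = (\<sigma> ^^ Suc n) x" for n by simp
    then show "\<sigma> ` {(\<sigma> ^^ n) x | n. n \<ge> m} \<subseteq> {(\<sigma> ^^ n) x | n. n \<ge> m}"
      using le_SucI by blast
  qed (use \<sigma>_pow_S assms(1) in auto)
  then show ?thesis using that assms(2) by blast
qed

definition shift :: "nat \<Rightarrow> (nat \<Rightarrow> 'a) \<Rightarrow> nat \<Rightarrow> 'a" where
  "shift n y = (\<lambda>j. (\<sigma> ^^ n) (y j))"

lemma shift_S: "(\<And>j. y j \<in> S) \<Longrightarrow> shift n y j \<in> S"
  by (simp add: shift_def \<sigma>_pow_S)

lemma shift_arc: "(\<And>j. y j \<in> S) \<Longrightarrow> E (shift n y j) (shift (Suc n) y j)"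
  using arc \<sigma>_S by (simp add: shift_def \<sigma>_pow_S)

lemma F_S: "(\<And>j. y j \<in> S) \<Longrightarrow> F y \<in> S"
  using subuniverse_F[OF subuniverse_S] .

text \<open>Within \<open>S\<close> the rotation is the only way to follow an arc, so preserving
  arcs means commuting with the simultaneous rotation.\<close>

lemma F_shift:
  assumes "\<And>j. y j \<in> S"
  shows "F (shift n y) = (\<sigma> ^^ n) (F y)"
proof (induction n)
  case 0
  then show ?case by (simp add: shift_def)
next
  case (Suc n)
  have "E (F (shift n y)) (F (shift (Suc n) y))"
    by (rule pol) (use assms shift_S S_V shift_arc in auto)
  moreover have "F (shift n y) \<in> S" "F (shift (Suc n) y) \<in> S"
    by (rule F_S, rule shift_S, rule assms)+
  ultimately show ?case using arc Suc by simp
qed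

lemma shift_upd: "(shift n y)(l := (\<sigma> ^^ n) s) = shift n (y(l := s))"
  by (auto simp: shift_def)

lemma relevant_shift:
  assumes "\<And>j. y j \<in> S" "relevant F S l y"
  shows "relevant F S l (shift n y)"
proof -
  obtain s t where st: "s \<in> S" "t \<in> S" "F (y(l := s)) \<noteq> F (y(l := t))"
    using assms(2) unfolding relevant_def by blast
  have "inj_on (\<sigma> ^^ n) S" by (induction n) (use \<sigma>_inj \<sigma>_pow_S in \<open>auto simp: inj_on_def\<close>)
  moreover have "F (y(l := s)) \<in> S" "F (y(l := t)) \<in> S" by (rule F_S; use assms(1) st in simp)+
  ultimately have "(\<sigma> ^^ n) (F (y(l := s))) \<noteq> (\<sigma> ^^ n) (F (y(l := t)))"
    using st(3) by (auto simp: inj_on_def)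
  moreover have "F ((shift n y)(l := (\<sigma> ^^ n) s)) = (\<sigma> ^^ n) (F (y(l := s)))" if "s \<in> S" for s
    unfolding shift_upd by (rule F_shift) (use assms(1) that in simp)
  ultimately show ?thesis unfolding relevant_def using st(1,2) \<sigma>_pow_S by metis
qed

text \<open>Two settings of the relevant position yield different vertices of \<open>S\<close> with
  an arc to the value, but a vertex of \<open>S\<close> has only one in-neighbour in
  \<open>S\<close>.\<close>

lemma relevant_not_S_out:
  assumes y: "\<And>j. y j \<in> S" and "relevant F S l y"
    and t: "t \<in> V" "\<And>s. s \<in> S \<Longrightarrow> E s t"
  shows "F ((shift (Suc n) y)(l := t)) \<notin> S" "\<exists>s\<in>S. E s (F ((shift (Suc n) y)(l := t)))"
proof -
  have "relevant F S l (shift n y)" by (rule relevant_shift[OF y assms(2)])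
  then obtain a b where ab: "a \<in> S" "b \<in> S" "F ((shift n y)(l := a)) \<noteq> F ((shift n y)(l := b))"
    unfolding relevant_def by blast
  have into: "E (F ((shift n y)(l := s))) (F ((shift (Suc n) y)(l := t)))" if "s \<in> S" for s
    by (rule pol) (use that t y shift_S shift_arc S_V in auto)
  have val: "F ((shift n y)(l := s)) \<in> S" if "s \<in> S" for s
    by (rule F_S) (use that y shift_S in auto)
  show "\<exists>s\<in>S. E s (F ((shift (Suc n) y)(l := t)))" using into val ab(1) by blast
  show "F ((shift (Suc n) y)(l := t)) \<notin> S"
    using into[OF ab(1)] into[OF ab(2)] val[OF ab(1)] val[OF ab(2)] ab(3) arc \<sigma>_inj by metis
qed

lemma relevant_not_S_in:
  assumes y: "\<And>j. y j \<in> S" and "relevant F S l y"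
    and t: "t \<in> V" "\<And>s. s \<in> S \<Longrightarrow> E t s"
  shows "F ((shift n y)(l := t)) \<notin> S" "\<exists>s\<in>S. E (F ((shift n y)(l := t))) s"
proof -
  have "relevant F S l (shift (Suc n) y)" by (rule relevant_shift[OF y assms(2)])
  then obtain a b where ab: "a \<in> S" "b \<in> S" "F ((shift (Suc n) y)(l := a)) \<noteq> F ((shift (Suc n) y)(l := b))"
    unfolding relevant_def by blast
  have out: "E (F ((shift n y)(l := t))) (F ((shift (Suc n) y)(l := s)))" if "s \<in> S" for s
    by (rule pol) (use that t y shift_S shift_arc S_V in auto)
  have val: "F ((shift (Suc n) y)(l := s)) \<in> S" if "s \<in> S" for s
    by (rule F_S) (use that y shift_S in auto)
  show "\<exists>s\<in>S. E (F ((shift n y)(l := t))) s" using out val ab(1) by blast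
  show "F ((shift n y)(l := t)) \<notin> S"
    using out[OF ab(1)] out[OF ab(2)] val[OF ab(1)] val[OF ab(2)] ab(3) arc by metis
qed

text \<open>With two relevant positions, the ends of longest walks in \<open>T\<close> and \<open>U\<close>, inserted at one position
  each, have as values an element of \<open>T\<close> without out-neighbour in \<open>T\<close> and an element of \<open>U\<close> without
  in-neighbour in \<open>U\<close>; the value in the middle, with both positions replaced, fits nowhere.\<close>

lemma proj_on_if_between:
  assumes V: "V = U \<union> S \<union> T" and "smooth_on E V"
    and ST: "\<And>s t. s \<in> S \<Longrightarrow> t \<in> T \<Longrightarrow> E s t \<and> \<not> E t s"
    and US: "\<And>u s. u \<in> U \<Longrightarrow> s \<in> S \<Longrightarrow> E u s \<and> \<not> E s u"
    and acyclic: "acyclic_on E U" "acyclic_on E T" and ne: "U \<noteq> {}" "T \<noteq> {}"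
  shows "\<exists>i. proj_on F i S"
proof (rule ccontr)
  assume "\<nexists>i. proj_on F i S"
  then obtain y l l' where y: "\<And>j. y j \<in> S" and l: "l \<noteq> l'" "relevant F S l y" "relevant F S l' y"
    using proj_or_two_relevant[of S] subuniverse_subset[OF subuniverse_S] by metis
  have fin': "finite U" "finite T" using fin V by auto
  have UV: "u \<in> V" if "u \<in> U" for u using that V by blast
  have TV: "t \<in> V" if "t \<in> T" for t using that V by blast
  have T_val: "F ((shift (Suc n) y)(l := t)) \<in> T" if "t \<in> T" for n t
  proof -
    have "F ((shift (Suc n) y)(l := t)) \<in> V"
      by (rule dom) (use that TV shift_S[OF y] S_V in auto)
    moreover have "F ((shift (Suc n) y)(l := t)) \<notin> S"
      "\<exists>s\<in>S. E s (F ((shift (Suc n) y)(l := t)))"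
      using relevant_not_S_out[OF y l(2) TV[OF that]] ST that by blast+
    ultimately show ?thesis using V US by blast
  qed
  have U_val: "F ((shift n y)(l' := u)) \<in> U" if "u \<in> U" for n u
  proof -
    have "F ((shift n y)(l' := u)) \<in> V"
      by (rule dom) (use that UV shift_S[OF y] S_V in auto)
    moreover have "F ((shift n y)(l' := u)) \<notin> S" "\<exists>s\<in>S. E (F ((shift n y)(l' := u))) s"
      using relevant_not_S_in[OF y l(3) UV[OF that]] US that by blast+
    ultimately show ?thesis using V ST by blast
  qed
  obtain p where p: "walk_in E T p (walk_length E T)"
    using walk_length_walk[OF fin'(2) acyclic(2)] by blast
  obtain q where q: "walk_in E U q (walk_length E U)"
    using walk_length_walk[OF fin'(1) acyclic(1)] by blast
  obtain D where D: "walk_length E T = Suc D"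
    using walk_length_pos[OF fin'(2) acyclic(2)] ne(2) gr0_implies_Suc by blast
  have "walk_length E U > 0" using walk_length_pos[OF fin'(1) acyclic(1)] ne(1) by blast
  then have q0: "q 0 \<in> U" using q by (simp add: walk_in_def)
  have pD: "p D \<in> T" using p D by (simp add: walk_in_def)
  define h where "h j = F ((shift (Suc j) y)(l := p j))" for j
  have h: "walk_in E T h (Suc D)"
    unfolding walk_in_def
  proof (intro conjI allI impI)
    show "h j \<in> T" if "j < Suc D" for j
      unfolding h_def by (rule T_val) (use that p D in \<open>simp add: walk_in_def\<close>)
    show "E (h j) (h (Suc j))" if "Suc j < Suc D" for j
      unfolding h_def
      by (rule pol) (use that p D TV shift_S[OF y] shift_arc[OF y] S_V in \<open>auto simp: walk_in_def\<close>)
  qed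
  \<comment> \<open>The offset leaves time \<open>D + 2\<close> for \<open>v\<close>, between
    \<open>h D\<close> at time \<open>D + 1\<close> and \<open>g 0\<close> at time
    \<open>D + 3\<close>.\<close>
  define g where "g j = F ((shift (Suc (Suc (Suc (D + j)))) y)(l' := q j))" for j
  have g: "walk_in E U g (walk_length E U)"
    unfolding walk_in_def
  proof (intro conjI allI impI)
    show "g j \<in> U" if "j < walk_length E U" for j
      unfolding g_def by (rule U_val) (use that q in \<open>simp add: walk_in_def\<close>)
    show "E (g j) (g (Suc j))" if "Suc j < walk_length E U" for j
      unfolding g_def add_Suc_right
      by (rule pol) (use that q UV shift_S[OF y] shift_arc[OF y] S_V in \<open>auto simp: walk_in_def\<close>)
  qed
  \<comment> \<open>The end of a longest walk in \<open>T\<close> has no out-neighbour in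
    \<open>T\<close>, and no arc leads from \<open>T\<close> to \<open>S\<close>; so smoothness
    supplies one in \<open>U\<close>. Dually for \<open>t\<close>.\<close>
  obtain u where u: "u \<in> U" "E (p D) u"
  proof -
    obtain u where "u \<in> V" "E (p D) u" using assms(2) pD TV unfolding smooth_on_def by blast
    moreover have "u \<notin> T"
      using longest_walk_last[OF fin'(2) acyclic(2) p[unfolded D] D] calculation by blast
    ultimately show ?thesis using that V ST pD by blast
  qed
  obtain t where t: "t \<in> T" "E t (q 0)"
  proof -
    obtain t where "t \<in> V" "E t (q 0)" using assms(2) q0 UV unfolding smooth_on_def by blast
    moreover have "t \<notin> U"
      using longest_walk_first[OF fin'(1) acyclic(1) q] calculation by blast
    ultimately show ?thesis using that V US q0 by blast
  qed
  define v where "v = F ((shift (Suc (Suc D)) y)(l := u, l' := t))"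
  have "v \<in> V" unfolding v_def by (rule dom) (use u t UV TV shift_S[OF y] S_V in auto)
  have "E (h D) v"
    unfolding h_def v_def
    by (rule pol) (use l(1) u t pD UV TV ST shift_S[OF y] shift_arc[OF y] S_V in auto)
  moreover have "E v (g 0)"
    unfolding g_def v_def add_0_right
    by (rule pol) (use l(1) u t q0 UV TV US shift_S[OF y] shift_arc[OF y] S_V in auto)
  moreover have "h D \<in> T" "g 0 \<in> U"
    using h g \<open>walk_length E U > 0\<close> by (auto simp: walk_in_def)
  moreover have "v \<notin> T"
    using longest_walk_last[OF fin'(2) acyclic(2) h D] calculation by blast
  moreover have "v \<notin> U"
    using longest_walk_first[OF fin'(1) acyclic(1) g] calculation by blast
  \<comment> \<open>Only \<open>S\<close> is left for \<open>v\<close>, but then the arc from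
    \<open>h D\<close> would lead from \<open>T\<close> to \<open>S\<close>.\<close>
  ultimately show False using V ST \<open>v \<in> V\<close> by blast
qed

text \<open>Positions along which \<open>F\<close> acts on the cycle as a rotation send stars to stars and, by
  counting, preserve the length of their longest walks. For two such positions the end of a longest
  walk of a star and the start of one get values in a common star that are joined by an arc.\<close>

definition star :: "'a \<Rightarrow> 'a set" where
  "star e = {v \<in> V. E e v \<and> (\<forall>s\<in>S - {e}. E v s)}"

lemma star_V: "v \<in> star e \<Longrightarrow> v \<in> V"
  by (simp add: star_def)

context
  fixes y :: "nat \<Rightarrow> 'a" and l :: nat
  assumes y: "\<And>j. y j \<in> S"
    and commute: "\<And>s. s \<in> S \<Longrightarrow> F (y(l := \<sigma> s)) = \<sigma> (F (y(l := s)))"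
begin

lemma slice_S: "s \<in> S \<Longrightarrow> F (y(l := s)) \<in> S"
  by (rule F_S) (use y in simp)

lemma slice_pow: "s \<in> S \<Longrightarrow> F (y(l := (\<sigma> ^^ n) s)) = (\<sigma> ^^ n) (F (y(l := s)))"
  by (induction n) (use commute \<sigma>_pow_S in auto)

text \<open>Rotating all positions and rotating position \<open>l\<close> alone have the same effect
  on the value, so the other positions may be rotated freely.\<close>

lemma slice_shift:
  assumes "s \<in> S"
  shows "F ((shift n y)(l := s)) = F (y(l := s))"
proof -
  obtain t where t: "t \<in> S" "s = (\<sigma> ^^ n) t" using \<sigma>_pow_surj[OF assms] by blast
  then have "F ((shift n y)(l := s)) = (\<sigma> ^^ n) (F (y(l := t)))"
    unfolding t(2) shift_upd by (intro F_shift) (use y in simp)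
  then show ?thesis using slice_pow[OF t(1)] t(2) by metis
qed

lemma slice_bij: "bij_betw (\<lambda>s. F (y(l := s))) S S"
proof -
  have "(\<lambda>s. F (y(l := s))) ` S = S"
    by (rule \<sigma>_invariant) (use slice_S cyclic_S commute \<sigma>_S in \<open>auto simp: cyclic_on_def simp flip: commute\<close>)
  then show ?thesis using finite_S finite_surj_inj[of S "\<lambda>s. F (y(l := s))"] by (simp add: bij_betw_def)
qed

text \<open>The arc into the value comes from the previous rotation of the tuple, the arcs out of it
  go to the next one; \<open>slice_bij\<close> reaches all vertices of \<open>S\<close> other than
  the image of \<open>e\<close>.\<close>

lemma slice_star:
  assumes "e \<in> S" "v \<in> star e"
  shows "F ((shift (Suc n) y)(l := v)) \<in> star (F (y(l := e)))"
proof -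
  let ?x = "F ((shift (Suc n) y)(l := v))"
  have V: "v \<in> V" "E e v" "\<And>s. s \<in> S \<Longrightarrow> s \<noteq> e \<Longrightarrow> E v s" using assms(2) by (auto simp: star_def)
  have "?x \<in> V" by (rule dom) (use V shift_S[OF y] S_V in auto)
  moreover have "E (F ((shift n y)(l := e))) ?x"
    by (rule pol) (use V assms shift_S[OF y] shift_arc[OF y] S_V in auto)
  moreover have "E ?x r" if r: "r \<in> S" "r \<noteq> F (y(l := e))" for r
  proof -
    obtain s where s: "s \<in> S" "r = F (y(l := s))" using slice_bij r(1) by (auto simp: bij_betw_def)
    then have "s \<noteq> e" using r by auto
    then have "E ?x (F ((shift (Suc (Suc n)) y)(l := s)))"
      by (intro pol) (use V s shift_S[OF y] shift_arc[OF y] S_V in auto)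
    then show ?thesis using slice_shift[OF s(1)] s(2) by simp
  qed
  ultimately show ?thesis using slice_shift[OF assms(1)] by (auto simp: star_def)
qed

lemma slice_star_walk:
  assumes "e \<in> S" "walk_in E (star e) p n"
  shows "walk_in E (star (F (y(l := e)))) (\<lambda>j. F ((shift (Suc (m + j)) y)(l := p j))) n"
  unfolding walk_in_def
proof (intro conjI allI impI)
  show "F ((shift (Suc (m + j)) y)(l := p j)) \<in> star (F (y(l := e)))" if "j < n" for j
    by (rule slice_star) (use that assms in \<open>auto simp: walk_in_def\<close>)
  show "E (F ((shift (Suc (m + j)) y)(l := p j))) (F ((shift (Suc (m + Suc j)) y)(l := p (Suc j))))"
    if j: "Suc j < n" for j
    unfolding add_Suc_right
  proof (rule pol)
    have "p j \<in> V" "p (Suc j) \<in> V" "E (p j) (p (Suc j))"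
      using j assms(2) star_V by (auto simp: walk_in_def dest: Suc_lessD)
    then show "((shift (Suc (m + j)) y)(l := p j)) i \<in> V"
      "((shift (Suc (Suc (m + j))) y)(l := p (Suc j))) i \<in> V"
      "E (((shift (Suc (m + j)) y)(l := p j)) i) (((shift (Suc (Suc (m + j))) y)(l := p (Suc j))) i)" for i
      using shift_S[OF y] shift_arc[OF y] S_V by auto
  qed
qed

lemma slice_star_length:
  assumes "\<And>e. e \<in> S \<Longrightarrow> acyclic_on E (star e)" "e \<in> S"
  shows "walk_length E (star (F (y(l := e)))) = walk_length E (star e)"
proof (rule permutation_mono_eq[OF finite_S slice_bij _ assms(2)])
  fix e assume e: "e \<in> S"
  have fin': "finite (star e)" for e using fin by (simp add: star_def)
  obtain p where "walk_in E (star e) p (walk_length E (star e))"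
    using walk_length_walk[OF fin' assms(1)[OF e]] by blast
  then show "walk_length E (star e) \<le> walk_length E (star (F (y(l := e))))"
    using walk_length_max[OF fin' assms(1)[OF slice_S[OF e]] slice_star_walk[OF e]] by blast
qed

end

lemma proj_on_if_star:
  assumes acyclic: "\<And>e. e \<in> S \<Longrightarrow> acyclic_on E (star e)" and e0: "e0 \<in> S" "star e0 \<noteq> {}"
    and commute: "\<And>y l s. (\<And>j. y j \<in> S) \<Longrightarrow> relevant F S l y \<Longrightarrow> s \<in> S \<Longrightarrow>
      F (y(l := \<sigma> s)) = \<sigma> (F (y(l := s)))"
  shows "\<exists>i. proj_on F i S"
proof (rule ccontr)
  assume "\<nexists>i. proj_on F i S"
  then obtain y l l' where y: "\<And>j. y j \<in> S" and l: "l \<noteq> l'" "relevant F S l y" "relevant F S l' y"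
    using proj_or_two_relevant[of S] subuniverse_subset[OF subuniverse_S] by metis
  note c = commute[OF y l(2)] and c' = commute[OF y l(3)]
  have fin': "finite (star e)" for e using fin by (simp add: star_def)
  define D where "D = walk_length E (star e0) - 1"
  have D: "walk_length E (star e0) = Suc D"
    using walk_length_pos[OF fin' acyclic[OF e0(1)]] e0(2) by (fastforce simp: D_def)
  \<comment> \<open>At time \<open>N\<close> the rotated tuple has \<open>e0\<close> at position
    \<open>l\<close>; \<open>N \<ge> Suc D\<close> leaves room for a walk of values that ends
    exactly then.\<close>
  obtain N where "N \<ge> Suc D" and N: "(\<sigma> ^^ N) (y l) = e0" using \<sigma>_orbit[OF y e0(1)] by blast
  then obtain m where m: "N = Suc (m + D)" by (metis add.commute add_Suc_right le_Suc_ex)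
  define e1 where "e1 = (\<sigma> ^^ N) (y l')"
  define f where "f = (\<sigma> ^^ N) (F y)"
  have e1: "e1 \<in> S" using y \<sigma>_pow_S by (simp add: e1_def)
  \<comment> \<open>Both slices pass through \<open>y\<close>, so advancing either position
    \<open>N\<close> times rotates \<open>F y\<close> by \<open>N\<close>; hence the stars of
    \<open>e0\<close> and \<open>e1\<close> are sent to the same star.\<close>
  have f: "F (y(l := e0)) = f" "F (y(l' := e1)) = f"
    using slice_pow[OF y c, of "y l" N] slice_pow[OF y c', of "y l'" N] y N
    by (simp_all add: e1_def f_def)
  have "f \<in> S" using F_S[OF y] \<sigma>_pow_S by (simp add: f_def)
  note acf = acyclic[OF this]
  have len: "walk_length E (star f) = Suc D" "walk_length E (star e1) = Suc D"
    using slice_star_length[OF y c acyclic e0(1)] slice_star_length[OF y c' acyclic e1] f D by simp_all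
  obtain p where p: "walk_in E (star e0) p (Suc D)"
    using walk_length_walk[OF fin' acyclic[OF e0(1)]] D by metis
  obtain q where q: "walk_in E (star e1) q (Suc D)"
    using walk_length_walk[OF fin' acyclic[OF e1]] len by metis
  define h where "h j = F ((shift (Suc (m + j)) y)(l := p j))" for j
  define g where "g j = F ((shift (Suc (N + j)) y)(l' := q j))" for j
  have h: "walk_in E (star f) h (Suc D)"
    using slice_star_walk[OF y c e0(1) p, of m] f(1) unfolding h_def by metis
  have g: "walk_in E (star f) g (Suc D)"
    using slice_star_walk[OF y c' e1 q, of N] f(2) unfolding g_def by metis
  have pD: "p D \<in> star e0" and q0: "q 0 \<in> star e1" using p q by (auto simp: walk_in_def)
  have "E (h D) (g 0)"
    unfolding h_def g_def m[symmetric] add_0_right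
  proof (rule pol)
    fix j
    show "((shift N y)(l := p D)) j \<in> V" using pD star_V S_V shift_S[OF y] by auto
    show "((shift (Suc N) y)(l' := q 0)) j \<in> V" using q0 star_V S_V shift_S[OF y] by auto
    have "\<sigma> e0 \<in> S - {e0}" using \<sigma>_S \<sigma>_neq e0(1) by blast
    then have "E (p D) (\<sigma> e0)" using pD by (simp add: star_def)
    moreover have "E e1 (q 0)" using q0 by (simp add: star_def)
    moreover have "shift (Suc N) y l = \<sigma> e0" "shift N y l' = e1"
      using N by (simp_all add: shift_def e1_def)
    ultimately show "E (((shift N y)(l := p D)) j) (((shift (Suc N) y)(l' := q 0)) j)"
      using l(1) shift_arc[OF y] by auto
  qed
  moreover have "g 0 \<in> star f" using g by (simp add: walk_in_def)
  ultimately show False using longest_walk_last[OF fin' acf h len(1)] by blast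
qed

end

section \<open>Strong digraphs\<close>

text \<open>A projection on any smooth subset would spread to \<open>V\<close>, and the induction
  supplies one on every proper branching subuniverse. A strong counterexample thus has neither, and
  the core of a proper subuniverse is empty or a short cycle.\<close>

locale minimal_counterexample = idempotent_polymorphism +
  assumes strong: "x \<in> V \<Longrightarrow> y \<in> V \<Longrightarrow> (x, y) \<in> (arcs_on E V)\<^sup>*"
    and branching: "branching_on E V"
    and minimal: "subuniverse Y \<Longrightarrow> branching_on E Y \<Longrightarrow> Y = V"
    and no_proj: "Y \<subseteq> V \<Longrightarrow> Y \<noteq> {} \<Longrightarrow> smooth_on E Y \<Longrightarrow> \<not> proj_on F i Y"
begin

lemma converse_counterexample: "minimal_counterexample (\<lambda>x y. E y x) V F k"
proof (intro minimal_counterexample.intro converse minimal_counterexample_axioms.intro)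
  have "arcs_on (\<lambda>x y. E y x) V = (arcs_on E V)\<inverse>" by (auto simp: arcs_on_def)
  then show "(x, y) \<in> (arcs_on (\<lambda>x y. E y x) V)\<^sup>*" if "x \<in> V" "y \<in> V" for x y
    using strong that by (simp add: rtrancl_converse)
qed (use branching minimal no_proj branching_on_converse[of E] smooth_on_converse[of E] in auto)

lemma smooth_V: "smooth_on E V"
  using branching by (simp add: branching_on_def)

lemma core_of_subuniverse:
  assumes "subuniverse K" "K \<noteq> V" "smooth_on E T" "T \<subseteq> K" "T \<noteq> {}"
  shows "cyclic_on E (core_on E K)" "subuniverse (core_on E K)" "core_on E K \<noteq> V"
proof -
  have "T \<subseteq> core_on E K" using assms core_on_greatest by metis
  then have ne: "core_on E K \<noteq> {}" using assms(5) by blast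
  show "subuniverse (core_on E K)" by (rule subuniverse_core[OF assms(1)])
  show neq: "core_on E K \<noteq> V"
    using core_on_subset[of E K] subuniverse_subset[OF assms(1)] assms(2) by blast
  show "cyclic_on E (core_on E K)"
    using minimal[OF subuniverse_core[OF assms(1)]] neq ne smooth_on_core[of E K]
    unfolding branching_on_def by blast
qed

lemma core_eq_cyclic:
  assumes "subuniverse K" "K \<noteq> V" "cyclic_on E S" "S \<subseteq> K"
  shows "core_on E K = S"
proof -
  have S: "smooth_on E S" "S \<noteq> {}" using assms(3) by (auto simp: cyclic_on_def)
  note core = core_of_subuniverse[OF assms(1,2) S(1) assms(4) S(2)]
  show ?thesis
    using cyclic_on_maximal[OF assms(3) core(1)] core_on_greatest[OF assms(4) S(1)]
      subuniverse_subset[OF core(2)] by blast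
qed

lemma out_closed_eq:
  assumes "A \<subseteq> V" "A \<noteq> {}" "\<And>x y. x \<in> A \<Longrightarrow> y \<in> V \<Longrightarrow> E x y \<Longrightarrow> y \<in> A"
  shows "A = V"
proof -
  obtain a where a: "a \<in> A" using assms(2) by blast
  have "v \<in> A" if "v \<in> V" for v
  proof -
    have "(a, v) \<in> (arcs_on E V)\<^sup>*" using strong a assms(1) that by blast
    then show ?thesis
      by (induction rule: rtrancl_induct) (use a assms(3) in \<open>auto simp: arcs_on_def\<close>)
  qed
  then show ?thesis using assms(1) by blast
qed

text \<open>Otherwise the out-neighbourhood \<open>K\<close> of \<open>S\<close> is a proper
  subuniverse with core \<open>S\<close>. This splits \<open>V\<close> into an acyclic part above
  \<open>S\<close>, the cycle \<open>S\<close> and an acyclic part below it, as in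
  \<open>proj_on_if_between\<close>.\<close>

lemma cyclic_in_neighbour:
  assumes S: "subuniverse S" "cyclic_on E S" and v: "v \<in> V" "v \<notin> S"
  shows "\<exists>s\<in>S. E s v"
proof (rule ccontr)
  assume not_in: "\<not> (\<exists>s\<in>S. E s v)"
  have SV: "S \<subseteq> V" by (rule subuniverse_subset[OF S(1)])
  obtain \<sigma> where \<sigma>: "bij_betw \<sigma> S S" "\<And>x y. x \<in> S \<Longrightarrow> y \<in> S \<Longrightarrow> E x y \<longleftrightarrow> y = \<sigma> x"
    using cyclic_on_succ[OF finite_subset[OF SV fin] S(2)] by blast
  interpret cyclic_set E V F k S \<sigma> by unfold_locales (use S \<sigma> in auto)
  have smooth_S: "smooth_on E S" and ne: "S \<noteq> {}" using S(2) by (auto simp: cyclic_on_def)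
  define K where "K = {y \<in> V. \<exists>x\<in>S. E x y}"
  define L where "L = {y \<in> V. \<exists>x\<in>S. E y x}"
  have SK: "S \<subseteq> K" "S \<subseteq> L" using smooth_S SV unfolding K_def L_def smooth_on_def by blast+
  have K: "subuniverse K" "K \<noteq> V" using subuniverse_out[OF S(1)] not_in v by (auto simp: K_def)
  have coreK: "core_on E K = S" by (rule core_eq_cyclic[OF K S(2) SK(1)])
  have K_out: "\<not> E t s" if "t \<in> K - S" "s \<in> S" for t s
  proof
    assume "E t s"
    then have "smooth_on E (insert t S)" using that smooth_S unfolding smooth_on_def K_def by blast
    then have "insert t S \<subseteq> S" using coreK core_on_greatest[of "insert t S" K E] that SK by blast
    then show False using that by blast
  qed
  have neT: "K - S \<noteq> {}"
  proof
    assume "K - S = {}"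
    then have "S = V" using out_closed_eq[of S] SV ne by (auto simp: K_def)
    then show False using v by blast
  qed
  then obtain t where "t \<in> K - S" by blast
  then have "t \<in> V - L" using K_out subuniverse_subset[OF K(1)] by (auto simp: L_def)
  then have L: "subuniverse L" "L \<noteq> V" using subuniverse_in[OF S(1)] by (auto simp: L_def)
  have coreL: "core_on E L = S" by (rule core_eq_cyclic[OF L S(2) SK(2)])
  have "\<exists>i. proj_on F i S"
  proof (rule proj_on_if_between[of "V - K" "K - S"])
    show "V = V - K \<union> S \<union> (K - S)" using SK SV subuniverse_subset[OF K(1)] by blast
    show "E s t \<and> \<not> E t s" if "s \<in> S" "t \<in> K - S" for s t
      using K_out[OF that(2,1)] semi[of s t] that SV subuniverse_subset[OF K(1)] by blast
    show US: "E u s \<and> \<not> E s u" if "u \<in> V - K" "s \<in> S" for u s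
      using semi[of s u] that SV SK unfolding K_def by blast
    show "acyclic_on E (V - K)"
      unfolding acyclic_on_def
    proof (intro allI impI)
      fix T assume T: "T \<subseteq> V - K" "smooth_on E T"
      then have "T \<union> S \<subseteq> L" using US SK ne unfolding L_def by blast
      then have "T \<union> S \<subseteq> S"
        using core_on_greatest[OF _ smooth_on_Un[OF T(2) smooth_S]] coreL by metis
      then show "T = {}" using T(1) SK by blast
    qed
    show "acyclic_on E (K - S)"
      unfolding acyclic_on_def
    proof (intro allI impI)
      fix T assume T: "T \<subseteq> K - S" "smooth_on E T"
      then have "T \<union> S \<subseteq> K" using SK by blast
      then have "T \<union> S \<subseteq> S"
        using core_on_greatest[OF _ smooth_on_Un[OF T(2) smooth_S]] coreK by metis
      then show "T = {}" using T(1) by blast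
    qed
  qed (use smooth_V v not_in neT in \<open>auto simp: K_def\<close>)
  then show False using no_proj[OF SV ne smooth_S] by blast
qed

lemma cyclic_out_neighbour:
  assumes "subuniverse S" "cyclic_on E S" "v \<in> V" "v \<notin> S"
  shows "\<exists>s\<in>S. E v s"
  using minimal_counterexample.cyclic_in_neighbour[OF converse_counterexample, of S v] assms
  by (simp add: cyclic_on_converse[of E])

text \<open>Iterated out-neighbourhoods of a vertex are subuniverses and reach \<open>V\<close> by
  primitivity. The one just before the first arrival at \<open>V\<close> contains in-neighbours of
  all vertices, its own included, so its core is not empty.\<close>

lemma subuniverse_cyclic_exists:
  obtains S where "subuniverse S" "cyclic_on E S" "S \<noteq> V"
proof -
  obtain N where N: "\<And>x y. x \<in> V \<Longrightarrow> y \<in> V \<Longrightarrow> (x, y) \<in> arcs_on E V ^^ N"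
    using primitive_if_strong[OF strong branching] by blast
  obtain a b where ab: "a \<in> V" "b \<in> V" "a \<noteq> b"
    using branching irr unfolding branching_on_def smooth_on_def by fastforce
  define B where "B n = (arcs_on E V ^^ n) `` {a}" for n
  have B_Suc: "B (Suc n) = {y \<in> V. \<exists>x\<in>B n. E x y}" if "B n \<subseteq> V" for n
    using that by (auto simp: B_def arcs_on_def)
  have B: "subuniverse (B n)" for n
  proof (induction n)
    case 0
    then show ?case using subuniverse_singleton[OF ab(1)] by (simp add: B_def)
  next
    case (Suc n)
    then show ?case using B_Suc[OF subuniverse_subset] subuniverse_out by metis
  qed
  have "B N = V" using N ab(1) subuniverse_subset[OF B] by (auto simp: B_def)
  define m where "m = (LEAST n. B n = V)"
  have m: "B m = V" unfolding m_def by (rule LeastI[of _ N]) fact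
  have "B 0 = {a}" by (simp add: B_def)
  then have "m \<noteq> 0" using m ab by (metis singletonD)
  then obtain r where r: "m = Suc r" using not0_implies_Suc by blast
  then have K: "B r \<noteq> V" using not_less_Least[of r "\<lambda>n. B n = V"] by (simp add: m_def)
  have "\<exists>w\<in>B r. E w v" if "v \<in> V" for v
    using m r B_Suc[OF subuniverse_subset[OF B]] that by blast
  then have "\<not> acyclic_on E (B r)"
    using subuniverse_subset[OF B, of r] ab(1) fin
    by (intro not_acyclic_if_source_free) (blast intro: finite_subset)+
  then obtain T where "T \<subseteq> B r" "smooth_on E T" "T \<noteq> {}" unfolding acyclic_on_def by blast
  then show ?thesis using that core_of_subuniverse[OF B K] by blast
qed

text \<open>A cycle \<open>Y\<close> inside \<open>star e\<close> would be the core of the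
  out-neighbourhood of \<open>e\<close>. But \<open>\<sigma> e\<close> also lies there and is joined
  to \<open>Y\<close> in both directions, which enlarges the core.\<close>

lemma star_acyclic:
  assumes "cyclic_set E V F k S \<sigma>" and e: "e \<in> S"
  shows "acyclic_on E (cyclic_set.star E V S e)"
proof (rule ccontr)
  interpret cyclic_set E V F k S \<sigma> by fact
  assume "\<not> acyclic_on E (star e)"
  then obtain T where T: "T \<subseteq> star e" "smooth_on E T" "T \<noteq> {}" unfolding acyclic_on_def by blast
  have eV: "e \<in> V" using e S_V by blast
  have "subuniverse (star e)"
    unfolding subuniverse_def
  proof (intro conjI allI impI)
    fix x :: "nat \<Rightarrow> 'a" assume x: "\<forall>j. x j \<in> star e"
    then have xV: "x j \<in> V" for j by (auto simp: star_def)
    have "E (F (\<lambda>_. e)) (F x)" by (rule pol) (use x xV eV in \<open>auto simp: star_def\<close>)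
    moreover have "E (F x) (F (\<lambda>_. s))" if "s \<in> S - {e}" for s
      by (rule pol) (use x xV S_V that in \<open>auto simp: star_def\<close>)
    ultimately show "F x \<in> star e" using idem eV S_V dom xV by (auto simp: star_def)
  qed (auto simp: star_def)
  moreover have "star e \<noteq> V" using eV irr by (auto simp: star_def)
  ultimately have core: "cyclic_on E (core_on E (star e))" "subuniverse (core_on E (star e))"
    using core_of_subuniverse T by blast+
  let ?Y = "core_on E (star e)"
  have Y: "?Y \<subseteq> star e" by (rule core_on_subset)
  let ?K = "{v \<in> V. \<exists>x\<in>{e}. E x v}"
  have K: "subuniverse ?K" "?K \<noteq> V" using subuniverse_out[OF subuniverse_singleton[OF eV]] eV irr by auto
  have "core_on E ?K = ?Y" by (rule core_eq_cyclic[OF K core(1)]) (use Y in \<open>auto simp: star_def\<close>)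
  have s: "\<sigma> e \<in> S" "\<sigma> e \<noteq> e" using e \<sigma>_S \<sigma>_neq by auto
  then have sY: "\<sigma> e \<notin> ?Y" using Y irr by (auto simp: star_def)
  then obtain y where y: "y \<in> ?Y" "E (\<sigma> e) y"
    using cyclic_out_neighbour[OF core(2,1)] s S_V by blast
  have "E y (\<sigma> e)" using y Y s by (auto simp: star_def)
  then have "smooth_on E (insert (\<sigma> e) ?Y)"
    using y smooth_on_core[of E "star e"] unfolding smooth_on_def by blast
  moreover have "insert (\<sigma> e) ?Y \<subseteq> ?K" using Y s S_V arc e by (auto simp: star_def)
  ultimately have "insert (\<sigma> e) ?Y \<subseteq> core_on E ?K" by (intro core_on_greatest)
  then show False using \<open>core_on E ?K = ?Y\<close> sY by blast
qed

text \<open>On two vertices a relevant slice is a permutation and so commutes with the exchange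
  \<open>\<sigma>\<close>; any outside vertex lies in one of the two stars.\<close>

lemma no_two_cycle_subuniverse:
  assumes "subuniverse {p, q}" "E p q" "E q p"
  shows False
proof -
  have neq: "p \<noteq> q" using assms irr by metis
  have pq: "p \<in> V" "q \<in> V" using subuniverse_subset[OF assms(1)] by auto
  have cyc: "cyclic_on E {p, q}" using assms(2,3) irr by (auto simp: cyclic_on_def smooth_on_def)
  then have "V \<noteq> {p, q}" using branching by (auto simp: branching_on_def)
  then obtain v where v: "v \<in> V" "v \<noteq> p" "v \<noteq> q" using pq by blast
  define \<sigma> where "\<sigma> x = (if x = p then q else p)" for x
  interpret cyclic_set E V F k "{p, q}" \<sigma>
  proof unfold_locales
    show "bij_betw \<sigma> {p, q} {p, q}" using neq by (auto simp: bij_betw_def \<sigma>_def)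
    show "E x y \<longleftrightarrow> y = \<sigma> x" if "x \<in> {p, q}" "y \<in> {p, q}" for x y
      using that assms neq irr by (auto simp: \<sigma>_def)
  qed (use assms cyc in auto)
  obtain e where "e \<in> {p, q}" "star e \<noteq> {}"
  proof -
    obtain s t where st: "s \<in> {p, q}" "t \<in> {p, q}" "E s v" "E v t"
      using cyclic_in_neighbour[OF assms(1) cyc v(1)] cyclic_out_neighbour[OF assms(1) cyc v(1)] v
      by auto
    consider "v \<in> star p" | "v \<in> star q"
      using st v semi[OF v(1) pq(1)] semi[OF v(1) pq(2)] neq unfolding star_def by fast
    then show ?thesis using that by cases auto
  qed
  moreover have "F (y(l := \<sigma> s)) = \<sigma> (F (y(l := s)))"
    if y: "\<And>j. y j \<in> {p, q}" and l: "relevant F {p, q} l y" and s: "s \<in> {p, q}" for y l s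
  proof -
    have "F (y(l := p)) \<noteq> F (y(l := q))" using l by (auto simp: relevant_def)
    moreover have "F (y(l := p)) \<in> {p, q}" "F (y(l := q)) \<in> {p, q}"
      by (rule F_S; use y in simp)+
    ultimately show ?thesis using s neq by (auto simp: \<sigma>_def)
  qed
  ultimately have "\<exists>i. proj_on F i {p, q}"
    using proj_on_if_star star_acyclic[OF cyclic_set_axioms] by blast
  then show False using no_proj[of "{p, q}"] cyc pq by (auto simp: cyclic_on_def)
qed

lemma no_two_cycle_in_subuniverse:
  assumes "subuniverse K" "K \<noteq> V" "p \<in> K" "q \<in> K" "E p q" "E q p"
  shows False
proof -
  have "cyclic_on E {p, q}" using assms(5,6) irr by (auto simp: cyclic_on_def smooth_on_def)
  then have "core_on E K = {p, q}" using core_eq_cyclic assms by blast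
  then show False using subuniverse_core[OF assms(1)] no_two_cycle_subuniverse assms(5,6) by metis
qed

lemma no_two_cycle_out: "x \<in> V \<Longrightarrow> p \<in> V \<Longrightarrow> q \<in> V \<Longrightarrow> E x p \<Longrightarrow> E x q \<Longrightarrow> E p q \<Longrightarrow> E q p \<Longrightarrow> False"
  using no_two_cycle_in_subuniverse[OF subuniverse_out[OF subuniverse_singleton], of x p q] irr by auto

lemma no_two_cycle_in: "x \<in> V \<Longrightarrow> p \<in> V \<Longrightarrow> q \<in> V \<Longrightarrow> E p x \<Longrightarrow> E q x \<Longrightarrow> E p q \<Longrightarrow> E q p \<Longrightarrow> False"
  using no_two_cycle_in_subuniverse[OF subuniverse_in[OF subuniverse_singleton], of x p q] irr by auto

lemma subuniverse_cyclic_three: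
  assumes "cyclic_set E V F k S \<sigma>" "x \<in> S"
  shows "\<sigma> (\<sigma> (\<sigma> x)) = x" "\<sigma> (\<sigma> x) \<noteq> x" "S = {x, \<sigma> x, \<sigma> (\<sigma> x)}"
proof -
  interpret cyclic_set E V F k S \<sigma> by fact
  have S: "x \<in> S" "\<sigma> x \<in> S" "\<sigma> (\<sigma> x) \<in> S" using assms(2) \<sigma>_S by auto
  show 2: "\<sigma> (\<sigma> x) \<noteq> x"
  proof
    assume eq: "\<sigma> (\<sigma> x) = x"
    have "{x, \<sigma> x} = S" by (rule \<sigma>_invariant) (use S eq in auto)
    then show False using no_two_cycle_subuniverse[of x "\<sigma> x"] subuniverse_S arc S eq by auto
  qed
  have "\<not> E x (\<sigma> (\<sigma> x))" using arc S \<sigma>_neq by metis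
  then have "E (\<sigma> (\<sigma> x)) x" using semi[of x "\<sigma> (\<sigma> x)"] S S_V 2 by auto
  then show 3: "\<sigma> (\<sigma> (\<sigma> x)) = x" using arc S by simp
  have "{x, \<sigma> x, \<sigma> (\<sigma> x)} = S" by (rule \<sigma>_invariant) (use S 3 in auto)
  then show "S = {x, \<sigma> x, \<sigma> (\<sigma> x)}" ..
qed

lemma no_two_cycle_at_cyclic:
  assumes "cyclic_set E V F k S \<sigma>" and v: "v \<in> V - S" and i: "i \<in> S" and vi: "E v i" "E i v"
  shows False
proof -
  interpret cyclic_set E V F k S \<sigma> by fact
  define j l where "j = \<sigma> i" and "l = \<sigma> j"
  note three = subuniverse_cyclic_three[OF assms(1) i, folded j_def l_def]
  have S: "j \<in> S" "l \<in> S" using i \<sigma>_S by (auto simp: j_def l_def)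
  have V: "i \<in> V" "j \<in> V" "l \<in> V" "v \<in> V" using S i v S_V by auto
  have E: "E i j" "E j l" "E l i" using arc i S three j_def l_def by auto
  have nE: "\<not> E i l" "\<not> E j i" "\<not> E l j" using arc i S three j_def l_def \<sigma>_neq by metis+
  have nv: "v \<noteq> i" "v \<noteq> j" "v \<noteq> l" using v S i by auto
  have "\<not> E l v" using no_two_cycle_out[OF V(3,1,4)] E vi by blast
  then have vl: "E v l" using semi V nv by blast
  have "\<not> E v j" using no_two_cycle_in[OF V(2,1,4)] E vi by blast
  then have jv: "E j v" using semi V nv by blast
  \<comment> \<open>\<open>M\<close> contains \<open>v\<close>, whose out-neighbours in
    \<open>S\<close> are \<open>i\<close> and \<open>l\<close>, and no in-neighbour of
    \<open>j\<close>; so \<open>K\<close> cuts \<open>S\<close> down to \<open>{i, l}\<close>. The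
    out-neighbourhood of \<open>K\<close> misses \<open>l\<close> but contains the 2-cycle of
    \<open>i\<close> and \<open>v\<close>.\<close>
  define M where "M = {y \<in> V. \<exists>x\<in>{i}. E x y} \<inter> {y \<in> V. \<exists>x\<in>{j}. E x y}"
  define K where "K = S \<inter> {y \<in> V. \<exists>x\<in>M. E x y}"
  have closedK: "subuniverse K"
    unfolding K_def M_def
    by (intro subuniverse_Int subuniverse_out subuniverse_singleton subuniverse_S V)
  have "v \<in> M" using V vi jv by (simp add: M_def)
  then have "i \<in> K" "l \<in> K" using vi vl V S i by (auto simp: K_def)
  moreover have "j \<notin> K" using no_two_cycle_out[OF V(1,2)] E by (auto simp: K_def M_def)
  ultimately have K: "K = {i, l}" using three(3) by (auto simp: K_def)
  have "l \<notin> {y \<in> V. \<exists>x\<in>K. E x y}" using K nE irr by auto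
  moreover have "i \<in> {y \<in> V. \<exists>x\<in>K. E x y}" "v \<in> {y \<in> V. \<exists>x\<in>K. E x y}" using K E vi V by auto
  ultimately show False using no_two_cycle_in_subuniverse[OF subuniverse_out[OF closedK], of i v] vi V by blast
qed

text \<open>Inserting the star vertex \<open>v\<close> shows that a slice of \<open>F\<close> on the
  triangle can only be constant or a rotation. Relevant slices are not constant, so they commute
  with \<open>\<sigma>\<close> and \<open>proj_on_if_star\<close> applies.\<close>

lemma no_star:
  assumes S: "subuniverse S" "cyclic_on E S" "S \<noteq> V" and e: "e \<in> S"
    and v: "v \<in> V" "E e v" "\<And>s. s \<in> S \<Longrightarrow> s \<noteq> e \<Longrightarrow> E v s"
  shows False
proof -
  obtain \<sigma> where \<sigma>: "bij_betw \<sigma> S S" "\<And>x y. x \<in> S \<Longrightarrow> y \<in> S \<Longrightarrow> E x y \<longleftrightarrow> y = \<sigma> x"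
    using cyclic_on_succ[OF finite_subset[OF subuniverse_subset[OF S(1)] fin] S(2)] by blast
  interpret cyclic_set E V F k S \<sigma> by unfold_locales (use S \<sigma> in auto)
  note three = subuniverse_cyclic_three[OF cyclic_set_axioms]
  have "F (y(l := \<sigma> s)) = \<sigma> (F (y(l := s)))"
    if y: "\<And>j. y j \<in> S" and l: "relevant F S l y" and s: "s \<in> S" for y l s
  proof -
    define \<psi> where "\<psi> s = F (y(l := s))" for s
    have \<psi>_S: "\<psi> s \<in> S" if "s \<in> S" for s
      unfolding \<psi>_def by (rule F_S) (use y that in simp)
    have ne: "\<psi> (\<sigma> (\<sigma> m)) \<noteq> \<sigma> (\<psi> m)" if m: "m \<in> S" for m
    proof
      assume eq: "\<psi> (\<sigma> (\<sigma> m)) = \<sigma> (\<psi> m)"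
      obtain n where n: "(\<sigma> ^^ n) m = e" using \<sigma>_orbit[OF m e] by blast
      have sh: "F ((shift n' y)(l := (\<sigma> ^^ n') r)) = (\<sigma> ^^ n') (\<psi> r)" if "r \<in> S" for r n'
        unfolding shift_upd \<psi>_def by (rule F_shift) (use y that in simp)
      \<comment> \<open>At time \<open>n\<close> the vertex \<open>m\<close> has been rotated to
        \<open>e\<close>, so \<open>?c\<close> has an arc to \<open>x\<close>. By \<open>eq\<close>
        the arc from \<open>x\<close> leads to \<open>?c\<close> rotated three times, which is
        \<open>?c\<close>: a 2-cycle through \<open>S\<close>.\<close>
      define x where "x = F ((shift (Suc n) y)(l := v))"
      let ?c = "(\<sigma> ^^ n) (\<psi> m)"
      have cS: "?c \<in> S" using \<psi>_S m \<sigma>_pow_S by blast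
      have x: "x \<in> V" unfolding x_def by (rule dom) (use v shift_S[OF y] S_V in auto)
      have "E (F ((shift n y)(l := e))) x"
        unfolding x_def by (rule pol) (use v e shift_S[OF y] shift_arc[OF y] S_V in auto)
      then have cx: "E ?c x" using sh[OF m, of n] n by simp
      let ?m = "\<sigma> (\<sigma> m)"
      let ?r = "(\<sigma> ^^ Suc (Suc n)) ?m"
      have mS: "?m \<in> S" using m \<sigma>_S by blast
      have "?r = \<sigma> (\<sigma> (\<sigma> (\<sigma> e)))"
        using n by (simp flip: funpow_swap1)
      then have r: "?r = \<sigma> e" using three(1)[OF e] by simp
      have "E x (F ((shift (Suc (Suc n)) y)(l := ?r)))"
        unfolding x_def
        by (rule pol) (use r v e \<sigma>_S \<sigma>_neq shift_S[OF y] shift_arc[OF y] S_V in auto)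
      moreover have "F ((shift (Suc (Suc n)) y)(l := ?r)) = (\<sigma> ^^ Suc (Suc n)) (\<sigma> (\<psi> m))"
        using sh[OF mS, of "Suc (Suc n)"] eq by simp
      moreover have "\<dots> = \<sigma> (\<sigma> (\<sigma> ?c))" by (simp flip: funpow_swap1)
      ultimately have xc: "E x ?c" using three(1)[OF cS] by simp
      show False
      proof (cases "x \<in> S")
        case True
        then have "x = \<sigma> ?c" "?c = \<sigma> x" using cx xc arc cS by blast+
        then show False using three(2)[OF cS] by simp
      next
        case False
        then show False using no_two_cycle_at_cyclic[OF cyclic_set_axioms _ cS xc cx] x by blast
      qed
    qed
    have step: "\<psi> (\<sigma> m) = \<psi> m \<or> \<psi> (\<sigma> m) = \<sigma> (\<psi> m)" if m: "m \<in> S" for m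
    proof -
      have "\<psi> m \<noteq> \<sigma> (\<psi> (\<sigma> m))" using ne[OF \<sigma>_S[OF m]] three(1)[OF m] by simp
      moreover have "\<psi> (\<sigma> m) \<in> {\<psi> m, \<sigma> (\<psi> m), \<sigma> (\<sigma> (\<psi> m))}"
        using three(3)[OF \<psi>_S[OF m]] \<psi>_S[OF \<sigma>_S[OF m]] by blast
      ultimately show ?thesis using three(1)[OF \<psi>_S[OF m]] by auto
    qed
    have "\<psi> (\<sigma> s) \<noteq> \<psi> s"
    proof
      assume 1: "\<psi> (\<sigma> s) = \<psi> s"
      have s2: "\<sigma> s \<in> S" "\<sigma> (\<sigma> s) \<in> S" using s \<sigma>_S by auto
      have "\<psi> (\<sigma> (\<sigma> s)) = \<psi> s"
        using step[OF s2(1)] ne[OF s] 1 by auto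
      then have "\<psi> r = \<psi> s" if "r \<in> S" for r using that three(3)[OF s] 1 by auto
      then show False using l unfolding relevant_def \<psi>_def by metis
    qed
    then show ?thesis using step[OF s] by (simp add: \<psi>_def)
  qed
  moreover have "v \<in> star e" using v by (simp add: star_def)
  ultimately have "\<exists>i. proj_on F i S"
    using proj_on_if_star[of e] star_acyclic[OF cyclic_set_axioms] e by blast
  then show False using no_proj[of S] subuniverse_subset[OF S(1)] S(2) by (auto simp: cyclic_on_def)
qed

lemma contradiction: False
proof -
  interpret dual: minimal_counterexample "\<lambda>x y. E y x" V F k by (rule converse_counterexample)
  obtain S where S: "subuniverse S" "cyclic_on E S" "S \<noteq> V" using subuniverse_cyclic_exists by blast
  obtain \<sigma> where \<sigma>: "bij_betw \<sigma> S S" "\<And>x y. x \<in> S \<Longrightarrow> y \<in> S \<Longrightarrow> E x y \<longleftrightarrow> y = \<sigma> x"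
    using cyclic_on_succ[OF finite_subset[OF subuniverse_subset[OF S(1)] fin] S(2)] by blast
  interpret cyclic_set E V F k S \<sigma> by unfold_locales (use S \<sigma> in auto)
  obtain v where v: "v \<in> V" "v \<notin> S" using S subuniverse_subset by blast
  obtain e r where e: "e \<in> S" "E e v" and r: "r \<in> S" "E v r"
    using cyclic_in_neighbour[OF S(1,2) v] cyclic_out_neighbour[OF S(1,2) v] by blast
  have three: "S = {e, \<sigma> e, \<sigma> (\<sigma> e)}" using subuniverse_cyclic_three[OF cyclic_set_axioms e(1)] by blast
  have total: "E v s \<or> E s v" if "s \<in> S" for s using semi v that S_V by blast
  have "r \<noteq> e" using no_two_cycle_at_cyclic[OF cyclic_set_axioms] v e r by blast
  \<comment> \<open>The arc between \<open>v\<close> and the third vertex of \<open>S\<close>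
    decides: \<open>v\<close> is in a star at \<open>e\<close>, or in a star at \<open>r\<close> of
    the converse digraph.\<close>
  show False
  proof (cases "\<forall>s\<in>S. s \<noteq> e \<longrightarrow> E v s")
    case True
    then show False using no_star[OF S e(1) v(1) e(2)] by blast
  next
    case False
    then have "E s v" if "s \<in> S" "s \<noteq> r" for s
      using that three r e total \<open>r \<noteq> e\<close> by auto
    then show False
      using dual.no_star[of S r v] S r v by (simp add: cyclic_on_converse[of E])
  qed
qed

end

section \<open>Digraphs that are not strong\<close>

context idempotent_polymorphism
begin

text \<open>An infinite walk of tuples is recorded rather than one tuple, because
  \<open>escapes_unique\<close> turns it into an infinite walk of values.\<close>

definition escapes :: "'a set \<Rightarrow> nat \<Rightarrow> bool" where
  "escapes I l \<longleftrightarrow> (\<exists>a. (\<forall>n j. a n j \<in> I) \<and> (\<forall>n j. E (a n j) (a (Suc n) j)) \<and>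
    (\<forall>n. \<forall>t\<in>V - I. F ((a n)(l := t)) \<notin> I))"

text \<open>If \<open>F\<close> is the \<open>i\<close>-th projection on \<open>I\<close>, a value
  in \<open>I\<close> could be put at position \<open>i\<close> of the preceding tuple and would
  receive an arc from itself. Otherwise \<open>I\<close> is a short cycle, and both of two relevant
  positions escape.\<close>

lemma escapes_initial:
  assumes I: "subuniverse I" "smooth_on E I" "I \<noteq> {}" and arcs: "\<And>s t. s \<in> I \<Longrightarrow> t \<in> V - I \<Longrightarrow> E s t"
    and proj: "branching_on E I \<Longrightarrow> \<exists>i. proj_on F i I"
  shows "(\<exists>i. proj_on F i I \<and> escapes I i) \<or> (\<exists>l l'. l \<noteq> l' \<and> escapes I l \<and> escapes I l')"
proof (cases "\<exists>i. proj_on F i I")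
  case True
  then obtain i where i: "proj_on F i I" by blast
  have IV: "x \<in> V" if "x \<in> I" for x using subuniverse_subset[OF I(1)] that by blast
  obtain s where "s \<in> I" using I(3) by blast
  then obtain c :: "nat \<Rightarrow> 'a" where c: "\<And>n. c n \<in> I" "\<And>n. E (c n) (c (Suc n))"
    using smooth_on_infinite_walk[of I E s] I(2) unfolding smooth_on_def by metis
  have "F ((\<lambda>_. c (Suc n))(i := t)) \<notin> I" if t: "t \<in> V - I" for n t
  proof
    let ?x = "F ((\<lambda>_. c (Suc n))(i := t))"
    assume x: "?x \<in> I"
    have "E (F ((\<lambda>_. c n)(i := ?x))) ?x"
      by (rule pol) (use x c t IV arcs in auto)
    moreover have "F ((\<lambda>_. c n)(i := ?x)) = ?x"
      using i[unfolded proj_on_def, rule_format, of "(\<lambda>_. c n)(i := ?x)"] c x by simp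
    ultimately show False using irr by simp
  qed
  then have "escapes I i"
    unfolding escapes_def by (intro exI[of _ "\<lambda>n _. c (Suc n)"]) (use c in auto)
  then show ?thesis using i by blast
next
  case False
  then have cyc: "cyclic_on E I" using proj I(2,3) unfolding branching_on_def by blast
  obtain \<sigma> where \<sigma>: "bij_betw \<sigma> I I" "\<And>x y. x \<in> I \<Longrightarrow> y \<in> I \<Longrightarrow> E x y \<longleftrightarrow> y = \<sigma> x"
    using cyclic_on_succ[OF finite_subset[OF subuniverse_subset[OF I(1)] fin] cyc] by blast
  interpret cyclic_set E V F k I \<sigma> by unfold_locales (use I cyc \<sigma> in auto)
  obtain y l l' where y: "\<And>j. y j \<in> I" and l: "l \<noteq> l'" "relevant F I l y" "relevant F I l' y"
    using proj_or_two_relevant[of I] subuniverse_subset[OF I(1)] False by metis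
  have "escapes I m" if m: "relevant F I m y" for m
  proof -
    have "F ((shift (Suc n) y)(m := t)) \<notin> I" if "t \<in> V - I" for n t
      by (rule relevant_not_S_out(1)[OF y m]) (use that arcs in auto)
    then show ?thesis
      unfolding escapes_def
      by (intro exI[of _ "\<lambda>n. shift (Suc n) y"]) (use shift_S[OF y] shift_arc[OF y] in auto)
  qed
  then show ?thesis using l by blast
qed

text \<open>Reversing arcs in \<open>escapes_initial\<close> would also reverse the walk of tuples
  in \<open>escapes\<close>; so the following tuple takes the role of the preceding one
  here.\<close>

lemma escapes_terminal:
  assumes I: "subuniverse I" "smooth_on E I" "I \<noteq> {}" and arcs: "\<And>s t. s \<in> I \<Longrightarrow> t \<in> V - I \<Longrightarrow> E t s"
    and proj: "branching_on E I \<Longrightarrow> \<exists>i. proj_on F i I"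
  shows "(\<exists>i. proj_on F i I \<and> escapes I i) \<or> (\<exists>l l'. l \<noteq> l' \<and> escapes I l \<and> escapes I l')"
proof (cases "\<exists>i. proj_on F i I")
  case True
  then obtain i where i: "proj_on F i I" by blast
  have IV: "x \<in> V" if "x \<in> I" for x using subuniverse_subset[OF I(1)] that by blast
  obtain s where "s \<in> I" using I(3) by blast
  then obtain c :: "nat \<Rightarrow> 'a" where c: "\<And>n. c n \<in> I" "\<And>n. E (c n) (c (Suc n))"
    using smooth_on_infinite_walk[of I E s] I(2) unfolding smooth_on_def by metis
  have "F ((\<lambda>_. c n)(i := t)) \<notin> I" if t: "t \<in> V - I" for n t
  proof
    let ?x = "F ((\<lambda>_. c n)(i := t))"
    assume x: "?x \<in> I"
    have "E ?x (F ((\<lambda>_. c (Suc n))(i := ?x)))"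
      by (rule pol) (use x c t IV arcs in auto)
    moreover have "F ((\<lambda>_. c (Suc n))(i := ?x)) = ?x"
      using i[unfolded proj_on_def, rule_format, of "(\<lambda>_. c (Suc n))(i := ?x)"] c x by simp
    ultimately show False using irr by simp
  qed
  then have "escapes I i"
    unfolding escapes_def by (intro exI[of _ "\<lambda>n _. c n"]) (use c in auto)
  then show ?thesis using i by blast
next
  case False
  then have cyc: "cyclic_on E I" using proj I(2,3) unfolding branching_on_def by blast
  obtain \<sigma> where \<sigma>: "bij_betw \<sigma> I I" "\<And>x y. x \<in> I \<Longrightarrow> y \<in> I \<Longrightarrow> E x y \<longleftrightarrow> y = \<sigma> x"
    using cyclic_on_succ[OF finite_subset[OF subuniverse_subset[OF I(1)] fin] cyc] by blast
  interpret cyclic_set E V F k I \<sigma> by unfold_locales (use I cyc \<sigma> in auto)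
  obtain y l l' where y: "\<And>j. y j \<in> I" and l: "l \<noteq> l'" "relevant F I l y" "relevant F I l' y"
    using proj_or_two_relevant[of I] subuniverse_subset[OF I(1)] False by metis
  have "escapes I m" if m: "relevant F I m y" for m
  proof -
    have "F ((shift n y)(m := t)) \<notin> I" if "t \<in> V - I" for n t
      by (rule relevant_not_S_in(1)[OF y m]) (use that arcs in auto)
    then show ?thesis
      unfolding escapes_def
      by (intro exI[of _ "\<lambda>n. shift n y"]) (use shift_S[OF y] shift_arc[OF y] in auto)
  qed
  then show ?thesis using l by blast
qed

text \<open>Two tuples that differ only by the roles of \<open>I\<close> and \<open>J\<close> at the positions \<open>l\<close> and \<open>l'\<close> would
  force an infinite walk outside \<open>I\<close> and \<open>J\<close>.\<close>

lemma escapes_unique: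
  assumes I: "subuniverse I" "\<And>s t. s \<in> I \<Longrightarrow> t \<in> V - I \<Longrightarrow> E s t" "escapes I l"
    and J: "subuniverse J" "\<And>s t. s \<in> J \<Longrightarrow> t \<in> V - J \<Longrightarrow> E t s \<and> \<not> E s t" "escapes J l'"
    and disj: "I \<inter> J = {}"
    and no_walk: "\<And>u :: nat \<Rightarrow> 'a. (\<And>n. u n \<in> V - I - J) \<Longrightarrow> (\<And>n. E (u n) (u (Suc n))) \<Longrightarrow> False"
  shows "l = l'"
proof (rule ccontr)
  assume neq: "l \<noteq> l'"
  obtain a where a: "\<And>n j. a n j \<in> I" "\<And>n j. E (a n j) (a (Suc n) j)"
    "\<And>n t. t \<in> V - I \<Longrightarrow> F ((a n)(l := t)) \<notin> I" using I(3) unfolding escapes_def by metis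
  obtain d where d: "\<And>n j. d n j \<in> J" "\<And>n j. E (d n j) (d (Suc n) j)"
    "\<And>n t. t \<in> V - J \<Longrightarrow> F ((d n)(l' := t)) \<notin> J" using J(3) unfolding escapes_def by metis
  have IV: "x \<in> V - J" if "x \<in> I" for x using subuniverse_subset[OF I(1)] disj that by blast
  have JV: "x \<in> V - I" if "x \<in> J" for x using subuniverse_subset[OF J(1)] disj that by blast
  define u where "u n = F ((a n)(l := d n l))" for n
  define v where "v n = F ((d n)(l' := a n l'))" for n
  have uV: "u n \<in> V" for n unfolding u_def by (rule dom) (use a d IV JV in auto)
  have vV: "v n \<in> V - J" for n
    unfolding v_def using d(3)[OF IV[OF a(1)]] dom[of "(d n)(l' := a n l')"] a d IV JV by auto
  have uI: "u n \<notin> I" for n unfolding u_def by (rule a(3)[OF JV[OF d(1)]])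
  \<comment> \<open>At \<open>l\<close> the arc runs inside \<open>J\<close>, at \<open>l'\<close>
    inside \<open>I\<close>, elsewhere from \<open>I\<close> to \<open>J\<close>. No arc leaves
    \<open>J\<close>, so \<open>u n\<close> in \<open>J\<close> would put \<open>v (Suc n)\<close>
    there too.\<close>
  have "E (u n) (v (Suc n))" for n
    unfolding u_def v_def by (rule pol) (use neq a d IV JV I(2) in auto)
  then have "u n \<notin> J" for n using J(2)[of "u n" "v (Suc n)"] vV by blast
  moreover have "E (u n) (u (Suc n))" for n
    unfolding u_def by (rule pol) (use a d IV JV in auto)
  ultimately show False using no_walk[of u] uV uI by blast
qed

text \<open>\<open>I\<close> is the largest sink-free part of the complement of \<open>A\<close>;
  adding an in-neighbour keeps it sink-free, so it is closed under in-neighbours and dominates the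
  rest. \<open>J\<close> is its dual inside \<open>A\<close>, and what remains on either side is
  acyclic.\<close>

lemma proj_on_if_not_strong:
  assumes smooth: "smooth_on E V" and A: "A \<subseteq> V" "A \<noteq> {}" "A \<noteq> V"
    and out: "\<And>x y. x \<in> A \<Longrightarrow> y \<in> V \<Longrightarrow> E x y \<Longrightarrow> y \<in> A"
    and proj: "\<And>Y. subuniverse Y \<Longrightarrow> Y \<noteq> V \<Longrightarrow> branching_on E Y \<Longrightarrow> \<exists>i. proj_on F i Y"
  shows "\<exists>i. proj_on F i V"
proof -
  define I where "I = \<Union>{T. T \<subseteq> V - A \<and> (\<forall>v\<in>T. \<exists>w\<in>T. E v w)}"
  define J where "J = \<Union>{T. T \<subseteq> A \<and> (\<forall>v\<in>T. \<exists>w\<in>T. E w v)}"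
  have I_max: "T \<subseteq> I" if "T \<subseteq> V - A" "\<And>v. v \<in> T \<Longrightarrow> \<exists>w\<in>T. E v w" for T
    using that by (auto simp: I_def)
  have J_max: "T \<subseteq> J" if "T \<subseteq> A" "\<And>v. v \<in> T \<Longrightarrow> \<exists>w\<in>T. E w v" for T
    using that by (auto simp: J_def)
  have IA: "I \<subseteq> V - A" and JA: "J \<subseteq> A" by (auto simp: I_def J_def)
  have I_out: "\<exists>w\<in>I. E v w" if "v \<in> I" for v using that unfolding I_def by blast
  have J_in: "\<exists>w\<in>J. E w v" if "v \<in> J" for v using that unfolding J_def by blast
  have I_closed: "y \<in> I" if "x \<in> I" "y \<in> V" "E y x" for x y
  proof -
    have "insert y I \<subseteq> I" by (rule I_max) (use that IA out I_out in auto)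
    then show ?thesis by blast
  qed
  have J_closed: "y \<in> J" if "x \<in> J" "y \<in> V" "E x y" for x y
  proof -
    have "insert y J \<subseteq> J" by (rule J_max) (use that JA out J_in in auto)
    then show ?thesis by blast
  qed
  have smoothI: "smooth_on E I" and smoothJ: "smooth_on E J"
    using smooth I_out J_in I_closed J_closed IA JA A(1) unfolding smooth_on_def by blast+
  have "\<not> acyclic_on E A"
    by (rule not_acyclic_if_sink_free[OF finite_subset[OF A(1) fin] A(2)])
      (use smooth A(1) out in \<open>unfold smooth_on_def, blast\<close>)
  then have neJ: "J \<noteq> {}" using J_max unfolding acyclic_on_def smooth_on_def by blast
  have "\<not> acyclic_on E (V - A)"
    by (rule not_acyclic_if_source_free) (use fin A smooth out in \<open>unfold smooth_on_def, blast+\<close>)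
  then have neI: "I \<noteq> {}" using I_max unfolding acyclic_on_def smooth_on_def by blast
  have disj: "I \<inter> J = {}" using IA JA by blast
  have arcI: "E s t \<and> \<not> E t s" if "s \<in> I" "t \<in> V - I" for s t
    using I_closed[of s t] semi[of s t] that IA by blast
  have arcJ: "E t s \<and> \<not> E s t" if "s \<in> J" "t \<in> V - J" for s t
    using J_closed[of s t] semi[of s t] that JA A(1) by blast
  have closedI: "subuniverse I" by (rule subuniverse_if_dominating) (use IA arcI in blast)+
  have closedJ: "subuniverse J"
    using idempotent_polymorphism.subuniverse_if_dominating[OF converse, of J] JA A(1) arcJ by blast
  have neq: "I \<noteq> V" "J \<noteq> V" using IA JA A by blast+
  have no_walk: False if u: "\<And>n. u n \<in> V - I - J" "\<And>n. E (u n) (u (Suc n))" for u :: "nat \<Rightarrow> 'a"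
  proof (cases "\<exists>n. u n \<in> A")
    case True
    then obtain n where n: "u n \<in> A" by blast
    have uA: "u (n + m) \<in> A" for m
    proof (induction m)
      case (Suc m)
      then show ?case using out[OF _ _ u(2)[of "n + m"]] u(1) by auto
    qed (use n in simp)
    have "acyclic_on E (A - J)" using J_max unfolding acyclic_on_def smooth_on_def by blast
    moreover have "finite (A - J)" using finite_subset[OF A(1) fin] by blast
    moreover have "u (n + m) \<in> A - J" for m using uA u(1) by blast
    ultimately show False
      using acyclic_on_no_infinite_walk[of "A - J" E "\<lambda>m. u (n + m)"] u(2) by simp
  next
    case False
    have "acyclic_on E (V - A - I)" using I_max unfolding acyclic_on_def smooth_on_def by blast
    moreover have "finite (V - A - I)" using fin by blast
    moreover have "u m \<in> V - A - I" for m using False u(1) by blast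
    ultimately show False using acyclic_on_no_infinite_walk[of "V - A - I" E u] u(2) by blast
  qed
  have unique: "l = l'" if "escapes I l" "escapes J l'" for l l'
    using escapes_unique[OF closedI _ that(1) closedJ _ that(2) disj] arcI arcJ no_walk by blast
  have "(\<exists>i. proj_on F i I \<and> escapes I i) \<or> (\<exists>l l'. l \<noteq> l' \<and> escapes I l \<and> escapes I l')"
    by (rule escapes_initial[OF closedI smoothI neI]) (use arcI proj closedI neq in blast)+
  moreover have "(\<exists>i. proj_on F i J \<and> escapes J i) \<or> (\<exists>l l'. l \<noteq> l' \<and> escapes J l \<and> escapes J l')"
    by (rule escapes_terminal[OF closedJ smoothJ neJ]) (use arcJ proj closedJ neq in blast)+
  \<comment> \<open>Every position escaping from \<open>I\<close> equals every one escaping from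
    \<open>J\<close>, so neither set has two of them; both carry a projection, to the same
    position.\<close>
  ultimately obtain i where i: "proj_on F i I" "proj_on F i J" using unique by metis
  have "proj_on F i V"
    by (rule proj_on_if_split[of I "V - I" I i J])
      (use IA JA A(1) arcI disj smooth smoothI smoothJ neI neJ i in blast)+
  then show ?thesis by blast
qed

end

section \<open>Induction on the number of vertices\<close>

theorem proj_on_if_branching:
  assumes "idempotent_polymorphism E V F k" "branching_on E V"
  shows "\<exists>i. proj_on F i V"
  using assms
proof (induction "card V" arbitrary: V rule: less_induct)
  case less
  interpret idempotent_polymorphism E V F k by (rule less.prems(1))
  have proj: "\<exists>i. proj_on F i Y" if Y: "subuniverse Y" "Y \<noteq> V" "branching_on E Y" for Y
  proof (rule less.hyps[OF _ subuniverse_idempotent_polymorphism[OF Y(1)] Y(3)])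
    show "card Y < card V" using subuniverse_subset[OF Y(1)] Y(2) fin by (simp add: psubset_card_mono psubsetI)
  qed
  show ?case
  proof (cases "\<forall>x\<in>V. \<forall>y\<in>V. (x, y) \<in> (arcs_on E V)\<^sup>*")
    case True
    then have strong: "\<And>x y. x \<in> V \<Longrightarrow> y \<in> V \<Longrightarrow> (x, y) \<in> (arcs_on E V)\<^sup>*" by blast
    note lift = proj_on_if_strong[OF strong less.prems(2)]
    show ?thesis
    proof (rule ccontr)
      assume none: "\<nexists>i. proj_on F i V"
      interpret minimal_counterexample E V F k
      proof unfold_locales
        show "(x, y) \<in> (arcs_on E V)\<^sup>*" if "x \<in> V" "y \<in> V" for x y using strong that .
        show "branching_on E V" by (rule less.prems(2))
        show no: "\<not> proj_on F i Y" if "Y \<subseteq> V" "Y \<noteq> {}" "smooth_on E Y" for Y i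
          using lift that none by blast
        show "Y = V" if Y: "subuniverse Y" "branching_on E Y" for Y
        proof (rule ccontr)
          assume "Y \<noteq> V"
          then obtain i where "proj_on F i Y" using proj Y by blast
          then show False using no[of Y i] subuniverse_subset[OF Y(1)] Y(2)
            unfolding branching_on_def by blast
        qed
      qed
      show False by (rule contradiction)
    qed
  next
    case False
    then obtain x y where xy: "x \<in> V" "y \<in> V" "(x, y) \<notin> (arcs_on E V)\<^sup>*" by blast
    define A where "A = {z \<in> V. (x, z) \<in> (arcs_on E V)\<^sup>*}"
    show ?thesis
    proof (rule proj_on_if_not_strong[of A])
      show "smooth_on E V" using less.prems(2) by (simp add: branching_on_def)
      show "A \<subseteq> V" "A \<noteq> {}" "A \<noteq> V" using xy by (auto simp: A_def)
      show "w \<in> A" if "v \<in> A" "w \<in> V" "E v w" for v w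
        using that unfolding A_def arcs_on_def by (auto intro: rtrancl_into_rtrancl)
    qed (rule proj)
  qed
qed

section \<open>The digraph with an added sink\<close>

lemma pcas_endpoints: "pcas u p v \<Longrightarrow> insert v (fst ` set p) = insert u (snd ` set p)"
  by (induction p arbitrary: u) auto

lemma closed_pcas_endpoints:
  assumes "pcas u p u" "p \<noteq> []"
  shows "fst ` set p = snd ` set p"
proof -
  have "u \<in> fst ` set p" using assms by (cases p) auto
  moreover have "pcas u p v \<Longrightarrow> p \<noteq> [] \<Longrightarrow> v \<in> snd ` set p" for u v and p :: "('a \<times> 'a) list"
    by (induction p arbitrary: u) (auto split: if_splits, metis list.distinct(1) pcas.simps(1))
  then have "u \<in> snd ` set p" using assms by blast
  ultimately show ?thesis using pcas_endpoints[OF assms(1)] by (simp add: insert_absorb)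
qed

lemma cycle_iff:
  "pre_digraph.cycle (with_proj G) p \<longleftrightarrow> p \<noteq> [] \<and>
    (\<exists>u\<in>pverts G. set p \<subseteq> parcs G \<and> pcas u p u \<and> distinct (tl (pawalk_verts u p)))"
  by (auto simp: pre_digraph.cycle_def pre_digraph.awalk_def cas_with_proj_eq awalk_verts_with_proj_eq)

lemma cycle_map:
  assumes "pre_digraph.cycle (with_proj G) p" "inj \<phi>" "\<phi> ` pverts G \<subseteq> pverts H"
    "\<And>u v. (u, v) \<in> parcs G \<Longrightarrow> (\<phi> u, \<phi> v) \<in> parcs H"
  shows "pre_digraph.cycle (with_proj H) (map (map_prod \<phi> \<phi>) p)"
proof -
  obtain u where u: "p \<noteq> []" "u \<in> pverts G" "set p \<subseteq> parcs G" "pcas u p u"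
    "distinct (tl (pawalk_verts u p))" using assms(1) unfolding cycle_iff by blast
  have "pcas u p v \<Longrightarrow> pcas (\<phi> u) (map (map_prod \<phi> \<phi>) p) (\<phi> v)" for u v p
    by (induction p arbitrary: u) auto
  then have "pcas (\<phi> u) (map (map_prod \<phi> \<phi>) p) (\<phi> u)" using u(4) .
  moreover have "pawalk_verts (\<phi> u) (map (map_prod \<phi> \<phi>) p) = map \<phi> (pawalk_verts u p)" for u p
    by (induction p arbitrary: u) auto
  then have "distinct (tl (pawalk_verts (\<phi> u) (map (map_prod \<phi> \<phi>) p)))"
    using u(5) inj_on_subset[OF assms(2) subset_UNIV] by (simp add: distinct_map flip: map_tl)
  moreover have "set (map (map_prod \<phi> \<phi>) p) \<subseteq> parcs H" using u(3) assms(4) by auto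
  moreover have "\<phi> u \<in> pverts H" using u(2) assms(3) by blast
  ultimately show ?thesis unfolding cycle_iff using u(1) by blast
qed

lemma more_than_one_cycle_map:
  assumes "more_than_one_cycle G" "inj \<phi>" "\<phi> ` pverts G \<subseteq> pverts H"
    "\<And>u v. (u, v) \<in> parcs G \<Longrightarrow> (\<phi> u, \<phi> v) \<in> parcs H"
  shows "more_than_one_cycle H"
proof -
  obtain c d where cd: "pre_digraph.cycle (with_proj G) c" "pre_digraph.cycle (with_proj G) d"
    "set c \<noteq> set d" using assms(1) unfolding more_than_one_cycle_def by blast
  have "inj (map_prod \<phi> \<phi>)" using assms(2) by (simp add: prod.inj_map)
  then have "set (map (map_prod \<phi> \<phi>) c) \<noteq> set (map (map_prod \<phi> \<phi>) d)"
    using cd(3) by (simp add: inj_image_eq_iff)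
  then show ?thesis
    using cycle_map[OF cd(1) assms(2-)] cycle_map[OF cd(2) assms(2-)]
    unfolding more_than_one_cycle_def by blast
qed

lemma semicomplete_digraphI:
  assumes "finite (pverts G)" "parcs G \<subseteq> pverts G \<times> pverts G" "\<And>x. (x, x) \<notin> parcs G"
    "\<And>x y. x \<in> pverts G \<Longrightarrow> y \<in> pverts G \<Longrightarrow> x \<noteq> y \<Longrightarrow> (x, y) \<in> parcs G \<or> (y, x) \<in> parcs G"
  shows "semicomplete_digraph G"
proof unfold_locales
  show "finite (parcs G)" by (rule finite_subset[OF assms(2)]) (use assms(1) in simp)
  show "fst e \<noteq> snd e" if "e \<in> parcs G" for e using assms(3)[of "fst e"] that by (cases e) auto
qed (use assms in auto)

lemma semicomplete_digraphD:
  assumes "semicomplete_digraph G"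
  shows "finite (pverts G)" "finite (parcs G)" "parcs G \<subseteq> pverts G \<times> pverts G" "(x, x) \<notin> parcs G"
    "x \<in> pverts G \<Longrightarrow> y \<in> pverts G \<Longrightarrow> x \<noteq> y \<Longrightarrow> (x, y) \<in> parcs G \<or> (y, x) \<in> parcs G"
proof -
  interpret semicomplete_digraph G by fact
  show "finite (pverts G)" "finite (parcs G)" by (rule pair_finite_verts, rule pair_finite_arcs)
  show "parcs G \<subseteq> pverts G \<times> pverts G" using arc_fst_in_verts arc_snd_in_verts by force
  show "(x, x) \<notin> parcs G" using pair_no_loops[of "(x, x)"] by auto
  show "x \<in> pverts G \<Longrightarrow> y \<in> pverts G \<Longrightarrow> x \<noteq> y \<Longrightarrow> (x, y) \<in> parcs G \<or> (y, x) \<in> parcs G"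
    by (rule semicomplete)
qed

lemma source_iff:
  assumes "finite (parcs G)"
  shows "source G v \<longleftrightarrow> v \<in> pverts G \<and> (\<forall>u. (u, v) \<notin> parcs G)"
proof -
  have "in_arcs (with_proj G) v = {(u, w) \<in> parcs G. w = v}" by (auto simp: in_arcs_def)
  moreover have "finite {(u, w) \<in> parcs G. w = v}" using assms by (auto intro: finite_subset[of _ "parcs G"])
  ultimately show ?thesis by (auto simp: source_def in_degree_def)
qed

lemma sink_iff:
  assumes "finite (parcs G)"
  shows "sink G v \<longleftrightarrow> v \<in> pverts G \<and> (\<forall>u. (v, u) \<notin> parcs G)"
proof -
  have "out_arcs (with_proj G) v = {(u, w) \<in> parcs G. u = v}" by (auto simp: out_arcs_def)
  moreover have "finite {(u, w) \<in> parcs G. u = v}" using assms by (auto intro: finite_subset[of _ "parcs G"])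
  ultimately show ?thesis by (auto simp: sink_def out_degree_def)
qed

lemma smooth_iff_smooth_on:
  assumes "semicomplete_digraph G"
  shows "smooth G \<longleftrightarrow> smooth_on (\<lambda>u v. (u, v) \<in> parcs G) (pverts G)"
  unfolding smooth_def smooth_on_def source_iff[OF semicomplete_digraphD(2)[OF assms]]
    sink_iff[OF semicomplete_digraphD(2)[OF assms]]
  using semicomplete_digraphD(3)[OF assms] by blast

text \<open>In a cyclic digraph the vertices of a cycle form a smooth set, hence all vertices; as
  out-neighbours are unique, its arcs are all arcs, and any two cycles coincide.\<close>

lemma branching_on_if_more_than_one_cycle:
  assumes G: "semicomplete_digraph G" "smooth G" "more_than_one_cycle G"
  shows "branching_on (\<lambda>u v. (u, v) \<in> parcs G) (pverts G)"
proof -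
  let ?E = "\<lambda>u v. (u, v) \<in> parcs G"
  \<comment> \<open>The first projection is taken as polymorphism to have the locale lemmas on
    cyclic sets at hand.\<close>
  interpret idempotent_polymorphism ?E "pverts G" "\<lambda>x. x 0" 1
    by unfold_locales (use semicomplete_digraphD[OF G(1)] in auto)
  have smooth: "smooth_on ?E (pverts G)" using G smooth_iff_smooth_on by blast
  have all_arcs: "set c = parcs G"
    if cyc: "cyclic_on ?E (pverts G)" and c: "pre_digraph.cycle (with_proj G) c" for c
  proof -
    obtain u where u: "c \<noteq> []" "set c \<subseteq> parcs G" "pcas u c u" using c unfolding cycle_iff by blast
    have ends: "fst ` set c = snd ` set c" by (rule closed_pcas_endpoints[OF u(3,1)])
    have "smooth_on ?E (snd ` set c)"
      unfolding smooth_on_def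
    proof
      fix v assume v: "v \<in> snd ` set c"
      then obtain a where "(a, v) \<in> set c" by force
      moreover obtain b where "(v, b) \<in> set c" using v ends by (metis imageE prod.collapse)
      moreover have "a \<in> snd ` set c" "b \<in> snd ` set c" using calculation ends by force+
      ultimately show "(\<exists>u\<in>snd ` set c. ?E u v) \<and> (\<exists>w\<in>snd ` set c. ?E v w)" using u(2) by blast
    qed
    moreover have "snd ` set c \<subseteq> pverts G" using u(2) semicomplete_digraphD(3)[OF G(1)] by force
    ultimately have all: "fst ` set c = pverts G"
      using cyclic_on_smooth_subset[OF cyc order.refl] u(1) ends by simp
    have "(x, y) \<in> set c" if xy: "(x, y) \<in> parcs G" for x y
    proof -
      have V: "x \<in> pverts G" "y \<in> pverts G" using xy semicomplete_digraphD(3)[OF G(1)] by auto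
      then obtain z where z: "(x, z) \<in> set c" using all by (metis imageE prod.collapse)
      then have "z \<in> pverts G" "(x, z) \<in> parcs G" using u(2) semicomplete_digraphD(3)[OF G(1)] by auto
      then have "y = z" using cyc xy V unfolding cyclic_on_def by blast
      then show ?thesis using z by simp
    qed
    then show ?thesis using u(2) by auto
  qed
  obtain c d where cd: "pre_digraph.cycle (with_proj G) c" "pre_digraph.cycle (with_proj G) d"
    "set c \<noteq> set d" using G(3) unfolding more_than_one_cycle_def by blast
  then have "\<not> cyclic_on ?E (pverts G)" using all_arcs by metis
  moreover have "pverts G \<noteq> {}" using cd(1) unfolding cycle_iff by blast
  ultimately show ?thesis using smooth by (simp add: branching_on_def)
qed

lemma pverts_add_sink: "pverts (add_sink G) = insert None (Some ` pverts G)"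
  by (simp add: add_sink_def)

lemma parcs_add_sink:
  "(Some u, Some v) \<in> parcs (add_sink G) \<longleftrightarrow> (u, v) \<in> parcs G"
  "(Some u, None) \<in> parcs (add_sink G) \<longleftrightarrow> u \<in> pverts G"
  "(None, x) \<notin> parcs (add_sink G)"
  by (auto simp: add_sink_def)

lemma semicomplete_digraph_add_sink:
  assumes "semicomplete_digraph G"
  shows "semicomplete_digraph (add_sink G)"
proof (rule semicomplete_digraphI)
  note G = semicomplete_digraphD[OF assms]
  show "finite (pverts (add_sink G))" using G(1) by (simp add: pverts_add_sink)
  show "parcs (add_sink G) \<subseteq> pverts (add_sink G) \<times> pverts (add_sink G)"
    using G(3) by (auto simp: add_sink_def)
  show "(x, x) \<notin> parcs (add_sink G)" for x
    using G(4) by (cases x) (auto simp: parcs_add_sink)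
  show "(x, y) \<in> parcs (add_sink G) \<or> (y, x) \<in> parcs (add_sink G)"
    if "x \<in> pverts (add_sink G)" "y \<in> pverts (add_sink G)" "x \<noteq> y" for x y
    using that by (auto simp: pverts_add_sink parcs_add_sink dest: G(5))
qed

section \<open>Saturation by in-neighbourhoods\<close>

definition in_neighbours :: "'a pair_pre_digraph \<Rightarrow> 'a \<Rightarrow> 'a set" where
  "in_neighbours G v = {u. (u, v) \<in> parcs G}"

text \<open>The largest semicomplete digraph in which every inclusion
  \<open>in_neighbours G v \<subseteq> in_neighbours G w\<close> persists.\<close>

definition saturation :: "'a pair_pre_digraph \<Rightarrow> 'a pair_pre_digraph" where
  "saturation G = \<lparr> pverts = pverts G,
    parcs = {(u, v). u \<in> pverts G \<and> v \<in> pverts G \<and> \<not> in_neighbours G v \<subseteq> in_neighbours G u} \<rparr>"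

lemma pverts_saturation [simp]: "pverts (saturation G) = pverts G"
  by (simp add: saturation_def)

lemma parcs_saturation:
  "(u, v) \<in> parcs (saturation G) \<longleftrightarrow>
    u \<in> pverts G \<and> v \<in> pverts G \<and> \<not> in_neighbours G v \<subseteq> in_neighbours G u"
  by (simp add: saturation_def)

text \<open>For an arc from \<open>u\<close> to \<open>v\<close>, the vertex \<open>u\<close> itself
  witnesses that the inclusion fails.\<close>

lemma parcs_subset_saturation:
  assumes "semicomplete_digraph G"
  shows "parcs G \<subseteq> parcs (saturation G)"
proof
  fix e assume e: "e \<in> parcs G"
  obtain u v where uv: "e = (u, v)" by (cases e)
  have "u \<in> in_neighbours G v" "u \<notin> in_neighbours G u"
    using e uv semicomplete_digraphD(4)[OF assms] by (auto simp: in_neighbours_def)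
  then show "e \<in> parcs (saturation G)"
    using e uv semicomplete_digraphD(3)[OF assms] by (auto simp: parcs_saturation)
qed

lemma semicomplete_digraph_saturation:
  assumes "semicomplete_digraph G"
  shows "semicomplete_digraph (saturation G)"
proof (rule semicomplete_digraphI)
  show "(x, y) \<in> parcs (saturation G) \<or> (y, x) \<in> parcs (saturation G)"
    if "x \<in> pverts (saturation G)" "y \<in> pverts (saturation G)" "x \<noteq> y" for x y
    using semicomplete_digraphD(5)[OF assms] parcs_subset_saturation[OF assms] that by auto
qed (use semicomplete_digraphD(1)[OF assms] in \<open>auto simp: parcs_saturation\<close>)

lemma smooth_saturation:
  assumes "semicomplete_digraph G" "smooth G"
  shows "smooth (saturation G)"
  using assms parcs_subset_saturation[OF assms(1)]
  unfolding smooth_iff_smooth_on[OF assms(1)] smooth_iff_smooth_on[OF semicomplete_digraph_saturation[OF assms(1)]]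
  unfolding smooth_on_def pverts_saturation by blast

lemma more_than_one_cycle_saturation:
  assumes "semicomplete_digraph G" "more_than_one_cycle G"
  shows "more_than_one_cycle (saturation G)"
  using more_than_one_cycle_map[OF assms(2), of "\<lambda>x. x" "saturation G"] parcs_subset_saturation[OF assms(1)]
  by auto

text \<open>If \<open>in_neighbours G p\<close> has minimal cardinality, then only \<open>p\<close> itself can lie below \<open>p\<close> in
  the inclusion order, and \<open>p\<close> does not lie below any of its in-neighbours \<open>q\<close>.\<close>

lemma saturation_cover:
  assumes "semicomplete_digraph G" "smooth G" "pverts G \<noteq> {}"
  obtains p q where "p \<in> pverts G" "q \<in> pverts G"
    "\<And>v. v \<in> pverts G \<Longrightarrow> (p, v) \<in> parcs (saturation G) \<or> (q, v) \<in> parcs (saturation G)"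
proof -
  note G = semicomplete_digraphD[OF assms(1)]
  have fin: "finite (in_neighbours G v)" for v
    by (rule finite_subset[OF _ G(1)]) (use G(3) in \<open>auto simp: in_neighbours_def\<close>)
  obtain p where p: "p \<in> pverts G"
    "\<And>v. v \<in> pverts G \<Longrightarrow> card (in_neighbours G p) \<le> card (in_neighbours G v)"
    using ex_min_if_finite[of "(\<lambda>v. card (in_neighbours G v)) ` pverts G"] G(1) assms(3)
    by (metis arg_min_least arg_min_if_finite(1))
  obtain q where q: "q \<in> pverts G" "(q, p) \<in> parcs G"
    using assms(2) p(1) unfolding smooth_iff_smooth_on[OF assms(1)] smooth_on_def by blast
  have "\<not> in_neighbours G p \<subseteq> in_neighbours G q" using q G(4) by (auto simp: in_neighbours_def)
  then have "\<not> (in_neighbours G v \<subseteq> in_neighbours G p \<and> in_neighbours G v \<subseteq> in_neighbours G q)"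
    if "v \<in> pverts G" for v
    using card_subset_eq[OF fin, of "in_neighbours G v" p] card_mono[OF fin, of "in_neighbours G v" p]
      p(2)[OF that] by auto
  then show ?thesis using that[of p q] p q by (auto simp: parcs_saturation)
qed

lemma novi_sad_add_sink_saturation:
  assumes "semicomplete_digraph G" "smooth G" "more_than_one_cycle G"
  shows "novi_sad (add_sink (saturation G))"
proof -
  let ?H = "saturation G"
  note H = semicomplete_digraph_saturation[OF assms(1)]
  note K = semicomplete_digraph_add_sink[OF H]
  have ne: "pverts G \<noteq> {}" using assms(3) unfolding more_than_one_cycle_def cycle_iff by blast
  have "more_than_one_cycle (add_sink ?H)"
    by (rule more_than_one_cycle_map[OF more_than_one_cycle_saturation[OF assms(1,3)], of Some])
      (auto simp: pverts_add_sink parcs_add_sink)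
  moreover have "\<not> source (add_sink ?H) v" for v
  proof
    assume "source (add_sink ?H) v"
    then have v: "v \<in> pverts (add_sink ?H)" "\<And>u. (u, v) \<notin> parcs (add_sink ?H)"
      unfolding source_iff[OF semicomplete_digraphD(2)[OF K]] by auto
    show False
    proof (cases v)
      case None
      then show False using v(2) ne by (auto simp: parcs_add_sink) (metis parcs_add_sink(2) pverts_saturation)
    next
      case (Some w)
      then have "w \<in> pverts ?H" using v(1) by (auto simp: pverts_add_sink)
      then obtain u where "(u, w) \<in> parcs ?H"
        using smooth_saturation[OF assms(1,2)] unfolding smooth_iff_smooth_on[OF H] smooth_on_def by blast
      then show False using v(2)[of "Some u"] Some by (simp add: parcs_add_sink)
    qed
  qed
  moreover obtain p q where pq: "p \<in> pverts G" "q \<in> pverts G"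
    "\<And>v. v \<in> pverts G \<Longrightarrow> (p, v) \<in> parcs ?H \<or> (q, v) \<in> parcs ?H"
    using saturation_cover[OF assms(1,2) ne] by blast
  then have "\<forall>v\<in>pverts (add_sink ?H). (Some p, v) \<in> parcs (add_sink ?H) \<or> (Some q, v) \<in> parcs (add_sink ?H)"
    by (auto simp: pverts_add_sink parcs_add_sink)
  ultimately show ?thesis
    using K pq(1,2) unfolding novi_sad_def pverts_add_sink pverts_saturation by blast
qed

lemma id_Pol_add_sink_saturation:
  assumes G: "semicomplete_digraph G" "smooth G" "more_than_one_cycle G"
  shows "id_Pol (add_sink G) \<subseteq> id_Pol (add_sink (saturation G))"
proof clarify
  fix k and f :: "(nat \<Rightarrow> 'a option) \<Rightarrow> 'a option"
  assume "(k, f) \<in> id_Pol (add_sink G)"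
  let ?V = "pverts G" and ?E = "\<lambda>u v. (u, v) \<in> parcs G" and ?W = "insert None (Some ` pverts G)"
  let ?P = "parcs (add_sink G)"
  have k: "k \<ge> 1" and f: "f \<in> ({..<k} \<rightarrow>\<^sub>E ?W) \<rightarrow>\<^sub>E ?W"
    and pol: "\<And>x y. x \<in> {..<k} \<rightarrow>\<^sub>E ?W \<Longrightarrow> y \<in> {..<k} \<rightarrow>\<^sub>E ?W \<Longrightarrow> (\<And>i. i < k \<Longrightarrow> (x i, y i) \<in> ?P) \<Longrightarrow>
      (f x, f y) \<in> ?P"
    and idem: "\<And>a. a \<in> ?W \<Longrightarrow> f (\<lambda>i\<in>{..<k}. a) = a"
    using \<open>(k, f) \<in> id_Pol (add_sink G)\<close> by (auto simp: id_Pol_def pverts_add_sink)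
  have fW: "f x \<in> ?W" if "x \<in> {..<k} \<rightarrow>\<^sub>E ?W" for x using f that by (rule PiE_mem)
  define T where "T X = (\<lambda>i\<in>{..<k}. Some (X i))" for X :: "nat \<Rightarrow> 'a"
  have T: "T X \<in> {..<k} \<rightarrow>\<^sub>E ?W" if "\<And>j. X j \<in> ?V" for X using that by (auto simp: T_def)
  define F where "F X = the (f (T X))" for X
  have F: "f (T X) = Some (F X)" "F X \<in> ?V" if X: "\<And>j. X j \<in> ?V" for X
  proof -
    \<comment> \<open>A tuple of old vertices has an arc to the constant tuple of the sink, so its
      value is not the sink, which has no out-neighbour.\<close>
    have "(f (T X), f (\<lambda>i\<in>{..<k}. None)) \<in> ?P"
      by (rule pol) (use X T in \<open>auto simp: T_def parcs_add_sink\<close>)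
    then have "f (T X) \<noteq> None" by (metis parcs_add_sink(3))
    moreover have "f (T X) \<in> ?W" by (rule fW[OF T]) (rule X)
    ultimately show "f (T X) = Some (F X)" "F X \<in> ?V" by (auto simp: F_def)
  qed
  have branching: "branching_on ?E ?V" by (rule branching_on_if_more_than_one_cycle[OF G])
  have smooth: "smooth_on ?E ?V" using branching by (simp add: branching_on_def)
  have "idempotent_polymorphism ?E ?V F k"
  proof unfold_locales
    show "F X \<in> ?V" if "\<And>j. X j \<in> ?V" for X by (rule F(2)) (rule that)
    show "F (\<lambda>_. x) = x" if "x \<in> ?V" for x
      using idem[of "Some x"] that by (simp add: F_def T_def)
    show "(F X, F Y) \<in> parcs G"
      if XY: "\<And>j. X j \<in> ?V" "\<And>j. Y j \<in> ?V" "\<And>j. (X j, Y j) \<in> parcs G" for X Y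
    proof -
      have "(f (T X), f (T Y)) \<in> ?P"
        by (rule pol[OF T T]) (use XY in \<open>auto simp: T_def parcs_add_sink\<close>)
      then show ?thesis using F(1)[OF XY(1)] F(1)[OF XY(2)] by (simp add: parcs_add_sink)
    qed
    show "F X = F Y" if "\<And>j. j < k \<Longrightarrow> X j = Y j" for X Y
    proof -
      have "T X = T Y" using that by (auto simp: T_def)
      then show ?thesis by (simp add: F_def)
    qed
  qed (use semicomplete_digraphD[OF G(1)] in auto)
  then obtain i where "proj_on F i ?V" using proj_on_if_branching branching by blast
  then have proj: "F X = X i" if "\<And>j. X j \<in> ?V" for X using that by (simp add: proj_on_def)
  obtain a b where ab: "a \<in> ?V" "b \<in> ?V" "a \<noteq> b"
    using branching semicomplete_digraphD(4)[OF G(1)] unfolding branching_on_def smooth_on_def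
    by (metis all_not_in_conv)
  \<comment> \<open>Tuples being functions on all of \<open>nat\<close>, \<open>proj_on\<close>
    alone does not bound \<open>i\<close>; two different vertices do.\<close>
  have i: "i < k"
  proof (rule ccontr)
    assume "\<not> i < k"
    then have "T ((\<lambda>_. a)(i := b)) = T (\<lambda>_. a)" by (auto simp: T_def)
    then have "F ((\<lambda>_. a)(i := b)) = F (\<lambda>_. a)" by (simp add: F_def)
    then show False using proj[of "(\<lambda>_. a)(i := b)"] proj[of "\<lambda>_. a"] ab by simp
  qed
  have value_without_sink: "f x = x i" if x: "x \<in> {..<k} \<rightarrow>\<^sub>E ?W" "\<And>j. j < k \<Longrightarrow> x j \<noteq> None" for x
  proof -
    define X where "X j = (if j < k then the (x j) else a)" for j
    have Xj: "x j = Some (X j)" "X j \<in> ?V" if "j < k" for j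
      using PiE_mem[OF x(1), of j] x(2)[OF that] that by (auto simp: X_def)
    have XV: "X j \<in> ?V" for j using Xj(2) ab(1) by (cases "j < k") (auto simp: X_def)
    have "T X = x"
    proof
      show "T X j = x j" for j
        using Xj(1)[of j] PiE_arb[OF x(1), of j] by (auto simp: T_def)
    qed
    then show ?thesis using F(1)[of X] proj[of X] XV Xj(1)[OF i] by simp
  qed
  \<comment> \<open>Every entry of \<open>y\<close> has an old in-neighbour. A tuple of these with
    \<open>u\<close> at position \<open>i\<close> has value \<open>u\<close>, whatever sinks
    \<open>y\<close> contains.\<close>
  have value_arc: "(Some u, f y) \<in> ?P" if y: "y \<in> {..<k} \<rightarrow>\<^sub>E ?W" and u: "u \<in> ?V" "(Some u, y i) \<in> ?P" for y u
  proof -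
    have "\<exists>v\<in>?V. (Some v, y j) \<in> ?P" if "j < k" for j
    proof (cases "y j")
      case None
      then show ?thesis using ab(1) by (auto simp: parcs_add_sink)
    next
      case (Some w)
      then have "w \<in> ?V" using PiE_mem[OF y, of j] that by auto
      then show ?thesis using smooth Some by (auto simp: smooth_on_def parcs_add_sink)
    qed
    then obtain p where p: "\<And>j. j < k \<Longrightarrow> p j \<in> ?V \<and> (Some (p j), y j) \<in> ?P" by metis
    define X where "X j = (if j = i then u else if j < k then p j else a)" for j
    have XV: "X j \<in> ?V" for j using p u ab(1) by (simp add: X_def)
    have "(f (T X), f y) \<in> ?P"
      by (rule pol[OF T[OF XV] y]) (use p u in \<open>auto simp: T_def X_def\<close>)
    then show ?thesis using F(1)[of X] proj[of X] XV by (simp add: X_def)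
  qed
  have "(f x, f y) \<in> parcs (add_sink (saturation G))"
    if x: "x \<in> {..<k} \<rightarrow>\<^sub>E ?W" and y: "y \<in> {..<k} \<rightarrow>\<^sub>E ?W"
      and xy: "\<forall>j<k. (x j, y j) \<in> parcs (add_sink (saturation G))" for x y
  proof -
    have "x j \<noteq> None" if "j < k" for j using xy that by (metis parcs_add_sink(3))
    then have fx: "f x = x i" by (rule value_without_sink[OF x])
    obtain u where u: "x i = Some u" using \<open>\<And>j. j < k \<Longrightarrow> x j \<noteq> None\<close>[OF i] by blast
    have uV: "u \<in> ?V" using PiE_mem[OF x, of i] u i by auto
    show ?thesis
    proof (cases "f y")
      case None
      then show ?thesis using fx u uV by (simp add: parcs_add_sink)
    next
      case (Some w)
      then have w: "w \<in> ?V" using fW[OF y] by auto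
      \<comment> \<open>Every old vertex has an arc to the sink, so \<open>value_arc\<close> would
        give one from \<open>w\<close> to itself.\<close>
      have "y i \<noteq> None"
      proof
        assume "y i = None"
        then show False
          using value_arc[OF y w] w Some semicomplete_digraphD(4)[OF G(1)] by (simp add: parcs_add_sink)
      qed
      then obtain v where v: "y i = Some v" by blast
      have "in_neighbours G v \<subseteq> in_neighbours G w"
      proof
        fix z assume z: "z \<in> in_neighbours G v"
        then have "z \<in> ?V" using semicomplete_digraphD(3)[OF G(1)] by (auto simp: in_neighbours_def)
        then show "z \<in> in_neighbours G w"
          using value_arc[OF y, of z] z v Some by (simp add: in_neighbours_def parcs_add_sink)
      qed
      moreover have "\<not> in_neighbours G v \<subseteq> in_neighbours G u"
        using xy i u v by (auto simp: parcs_add_sink parcs_saturation)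
      ultimately show ?thesis using fx u uV w Some by (auto simp: parcs_add_sink parcs_saturation)
    qed
  qed
  then show "(k, f) \<in> id_Pol (add_sink (saturation G))"
    using k f idem unfolding id_Pol_def pverts_add_sink pverts_saturation by auto
qed

theorem theorem4:
  fixes G :: "'a pair_pre_digraph"
  assumes "semicomplete_digraph G" and "smooth G" and "more_than_one_cycle G"
  shows "\<exists>H :: 'a pair_pre_digraph.
    semicomplete_digraph H \<and> smooth H \<and> pverts H = pverts G \<and> more_than_one_cycle H \<and>
    id_Pol (add_sink G) \<subseteq> id_Pol (add_sink H) \<and> novi_sad (add_sink H)"
proof (intro exI[of _ "saturation G"] conjI)
  show "semicomplete_digraph (saturation G)" by (rule semicomplete_digraph_saturation[OF assms(1)])
  show "smooth (saturation G)" by (rule smooth_saturation[OF assms(1,2)])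
  show "pverts (saturation G) = pverts G" by (rule pverts_saturation)
  show "more_than_one_cycle (saturation G)" by (rule more_than_one_cycle_saturation[OF assms(1,3)])
  show "id_Pol (add_sink G) \<subseteq> id_Pol (add_sink (saturation G))"
    by (rule id_Pol_add_sink_saturation[OF assms])
  show "novi_sad (add_sink (saturation G))" by (rule novi_sad_add_sink_saturation[OF assms])
qed

end
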